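(* Let $3\le n\le m$, let $\omega\in\Lambda^n\mathbb{R}^m$ be a calibration, and let $F\colon\Omega\to\mathbb{R}^m$ be a nonconstant conformal $\omega$-curve in a domain $\Omega\subset\mathbb{R}^n$. Then $F$ is the restriction of a Möbius transformation $\mathbb{S}^m\to\mathbb{S}^m$ if and only if $F$ is an inner Möbius curve.
   Context: Covectors in $\Lambda^n\mathbb{R}^m$ are identified with constant-coefficient differential $n$-forms on $\mathbb{R}^m$. A covector $\omega\in\Lambda^n\mathbb{R}^m$ is a calibration if $\|\omega\|_{\mathrm{comass}}:=\sup\{\omega(v_1,\ldots,v_n): v_i\in\mathbb{R}^m, |v_1|=\cdots=|v_n|=1\}=1$. $\mathrm{SO}(\omega)$ is the set of linear isometries $O\colon\mathbb{R}^n\to\mathbb{R}^m$ with $O^*\omega=\mathrm{vol}_{\mathbb{R}^n}$, and $\mathrm{CO}(\omega)=\{\lambda O: O\in\mathrm{SO}(\omega),\lambda\ge0\}$. A map $F\in W^{1,n}_{\mathrm{loc}}(\Omega,\mathbb{R}^m)$, $\Omega\subset\mathbb{R}^n$ open, is a conformal $\omega$-curve if $(DF)_x\in\mathrm{CO}(\omega)$ for a.e. $x\in\Omega$; such maps are identified with their continuous (in fact $\mathcal{C}^1$) representatives. $\mathbb{S}^k$ is identified with $\mathbb{R}^k\cup\{\infty\}$ via stereographic projection. A (nonconstant) Möbius transformation $\mathbb{S}^k\to\mathbb{S}^k$ is an orientation-preserving map given by $x\mapsto y_0+L\big((x-x_0)/|x-x_0|^{\epsilon}\big)$, where $x_0,y_0\in\mathbb{R}^k$,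 $\epsilon\in\{0,2\}$, $L=\lambda O$ with $\lambda>0$, $O\in\mathrm{O}(k)$, with $\det O=1$ if $\epsilon=0$ and $\det O=-1$ if $\epsilon=2$ (extended continuously to $\mathbb{S}^k$). $\mathbb{R}^n$ is identified with $\mathbb{R}^n\times\{0\}\subset\mathbb{R}^m$, so that $\Omega\subset\mathbb{R}^n\subset\mathbb{R}^m\subset\mathbb{S}^m$ and one may speak of $F$ being a restriction to $\Omega$ of a map $\mathbb{S}^m\to\mathbb{S}^m$. A map $F\colon\Omega\to\mathbb{R}^m$, $\Omega\subset\mathbb{R}^n$ open, is an inner Möbius curve if $F=A\circ g$, where $A\colon\mathbb{R}^n\to\mathbb{R}^m$, $A(x)=y_0+Lx$ with $y_0\in\mathbb{R}^m$ and $L\colon\mathbb{R}^n\to\mathbb{R}^m$ a linear isometry (orthogonal linear map), and $g\colon\Omega\to\mathbb{R}^n$ is the restriction of a (nonconstant) Möbius transformation $\mathbb{S}^n\to\mathbb{S}^n$.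
   Formalization: When n = m, the formal theorem assumes ω = vol; for n = m and ω = −vol the claim fails, since a reflection is a nonconstant conformal ω-curve and an inner Möbius curve but reverses orientation, so it is not a restriction of a Möbius transformation. *)

theory Defs
  imports "HOL-Analysis.Analysis"
begin

section \<open>Covectors and calibrations\<close>

text \<open>
  An \<open>n\<close>-covector on \<open>real ^ 'm\<close>, where \<open>n = CARD('n)\<close>, is an alternating multilinear function of
  families of vectors indexed by \<open>'n\<close>.  The index types carry no order, and none is needed: the
  determinant below does not change when rows and columns are relabelled simultaneously, so
  \<open>vol\<close> is the standard volume form whichever enumeration of \<open>'n\<close> is chosen.
\<close>

definition covector :: "(('n::finite \<Rightarrow> real ^ 'm::finite) \<Rightarrow> real) \<Rightarrow> bool" where
  "covector \<omega> \<longleftrightarrow>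
     (\<forall>i v. linear (\<lambda>x. \<omega> (v(i := x)))) \<and>
     (\<forall>v i j. i \<noteq> j \<and> v i = v j \<longrightarrow> \<omega> v = 0)"

definition comass :: "(('n::finite \<Rightarrow> real ^ 'm::finite) \<Rightarrow> real) \<Rightarrow> real" where
  "comass \<omega> = Sup {\<omega> v | v. \<forall>i. norm (v i) = 1}"

definition calibration :: "(('n::finite \<Rightarrow> real ^ 'm::finite) \<Rightarrow> real) \<Rightarrow> bool" where
  "calibration \<omega> \<longleftrightarrow> covector \<omega> \<and> comass \<omega> = 1"

definition vol :: "('n::finite \<Rightarrow> real ^ 'n) \<Rightarrow> real" where
  "vol v = det (\<chi> i. v i)"

definition pullback ::
  "(real ^ 'n \<Rightarrow> real ^ 'm) \<Rightarrow> (('n::finite \<Rightarrow> real ^ 'm::finite) \<Rightarrow> real) \<Rightarrow> ('n \<Rightarrow> real ^ 'n) \<Rightarrow> real" where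
  "pullback L \<omega> v = \<omega> (L \<circ> v)"

definition linear_isometry :: "(real ^ 'n::finite \<Rightarrow> real ^ 'm::finite) \<Rightarrow> bool" where
  "linear_isometry L \<longleftrightarrow> linear L \<and> (\<forall>x. norm (L x) = norm x)"

definition SO :: "(('n::finite \<Rightarrow> real ^ 'm::finite) \<Rightarrow> real) \<Rightarrow> (real ^ 'n \<Rightarrow> real ^ 'm) set" where
  "SO \<omega> = {L. linear_isometry L \<and> pullback L \<omega> = vol}"

definition CO :: "(('n::finite \<Rightarrow> real ^ 'm::finite) \<Rightarrow> real) \<Rightarrow> (real ^ 'n \<Rightarrow> real ^ 'm) set" where
  "CO \<omega> = {(\<lambda>x. c *\<^sub>R L x) | c L. L \<in> SO \<omega> \<and> 0 \<le> c}"


section \<open>Sobolev maps and conformal \<open>\<omega>\<close>-curves\<close>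

text \<open>Functions of class \<open>C\<^sup>k\<close> on the whole space.\<close>

primrec Ck :: "nat \<Rightarrow> (real ^ 'n::finite \<Rightarrow> real) \<Rightarrow> bool" where
  "Ck 0 f \<longleftrightarrow> continuous_on UNIV f"
| "Ck (Suc k) f \<longleftrightarrow>
     f differentiable_on UNIV \<and> (\<forall>v. Ck k (\<lambda>x. frechet_derivative f (at x) v))"

definition test_function :: "(real ^ 'n::finite) set \<Rightarrow> (real ^ 'n \<Rightarrow> real) \<Rightarrow> bool" where
  "test_function \<Omega> \<phi> \<longleftrightarrow>
     (\<forall>k. Ck k \<phi>) \<and> compact (closure {x. \<phi> x \<noteq> 0}) \<and> closure {x. \<phi> x \<noteq> 0} \<subseteq> \<Omega>"

definition Lp_loc ::
  "nat \<Rightarrow> (real ^ 'n::finite) set \<Rightarrow> (real ^ 'n \<Rightarrow> 'b::euclidean_space) \<Rightarrow> bool" where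
  "Lp_loc p \<Omega> f \<longleftrightarrow>
     f \<in> borel_measurable (lebesgue_on \<Omega>) \<and>
     (\<forall>K. compact K \<and> K \<subseteq> \<Omega> \<longrightarrow> integrable (lebesgue_on K) (\<lambda>x. norm (f x) ^ p))"

text \<open>
  \<open>G x\<close> is the Jacobian matrix of the weak differential at \<open>x\<close>; its \<open>i\<close>-th column is the weak
  partial derivative in direction \<open>i\<close>.  Bochner integrals of non-integrable functions are 0, so
  the definition is meaningful only for locally integrable \<open>F\<close> and \<open>G\<close>.
\<close>

definition weak_derivative ::
  "(real ^ 'n::finite) set \<Rightarrow> (real ^ 'n \<Rightarrow> real ^ 'm::finite) \<Rightarrow> (real ^ 'n \<Rightarrow> real ^ 'n ^ 'm) \<Rightarrow> bool" where
  "weak_derivative \<Omega> F G \<longleftrightarrow>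
     (\<forall>\<phi> i. test_function \<Omega> \<phi> \<longrightarrow>
        (LINT x|lebesgue_on \<Omega>. frechet_derivative \<phi> (at x) (axis i 1) *\<^sub>R F x) =
        - (LINT x|lebesgue_on \<Omega>. \<phi> x *\<^sub>R column i (G x)))"

definition W1_loc ::
  "nat \<Rightarrow> (real ^ 'n::finite) set \<Rightarrow> (real ^ 'n \<Rightarrow> real ^ 'm::finite) \<Rightarrow> (real ^ 'n \<Rightarrow> real ^ 'n ^ 'm) \<Rightarrow> bool" where
  "W1_loc p \<Omega> F G \<longleftrightarrow> Lp_loc p \<Omega> F \<and> Lp_loc p \<Omega> G \<and> weak_derivative \<Omega> F G"

text \<open>
  The weak differential \<open>G\<close> is determined up to null sets, so the choice of \<open>G\<close> carries
  no information.  This predicate depends only on the almost-everywhere class of \<open>F\<close>; passing to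
  the continuous representative is a separate \<open>continuous_on\<close> hypothesis.
\<close>

definition conformal_curve ::
  "(('n::finite \<Rightarrow> real ^ 'm::finite) \<Rightarrow> real) \<Rightarrow> (real ^ 'n) set \<Rightarrow> (real ^ 'n \<Rightarrow> real ^ 'm) \<Rightarrow> bool" where
  "conformal_curve \<omega> \<Omega> F \<longleftrightarrow>
     (\<exists>G. W1_loc CARD('n) \<Omega> F G \<and> (AE x in lebesgue_on \<Omega>. (\<lambda>h. G x *v h) \<in> CO \<omega>))"


section \<open>Moebius transformations\<close>

text \<open>
  The sphere \<open>S^k\<close> is \<open>real ^ 'k\<close> with a point at infinity, encoded as an option type with
  \<open>None\<close> as the point at infinity, as in the library's \<open>Alexandroff_compactification\<close>.
  The values at infinity, and at \<open>x0\<close> when \<open>\<epsilon> = 2\<close>, are those of the continuous extension.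
  The determinant of \<open>Q\<close> is prescribed so that the map preserves orientation, since
  the inversion \<open>\<epsilon> = 2\<close> reverses it.

  Consequence for \<open>n = m\<close>: with \<open>\<omega> = - vol\<close>, a reflection is a conformal \<open>\<omega>\<close>-curve and an inner
  Moebius curve, but reverses orientation and so is not a Moebius transformation; a comparison of
  the two notions has to fix \<open>\<omega> = vol\<close> when \<open>n = m\<close>.
\<close>

definition moebius_map ::
  "nat \<Rightarrow> real ^ 'k \<Rightarrow> real ^ 'k \<Rightarrow> real \<Rightarrow> real ^ 'k ^ 'k \<Rightarrow> (real ^ 'k::finite) option \<Rightarrow> (real ^ 'k) option" where
  "moebius_map \<epsilon> x0 y0 c Q p =
     (case p of
        None \<Rightarrow> if \<epsilon> = 0 then None else Some y0
      | Some x \<Rightarrow>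
          if \<epsilon> = 2 \<and> x = x0 then None
          else Some (y0 + c *\<^sub>R (Q *v ((x - x0) /\<^sub>R norm (x - x0) ^ \<epsilon>))))"

definition moebius :: "((real ^ 'k::finite) option \<Rightarrow> (real ^ 'k) option) \<Rightarrow> bool" where
  "moebius T \<longleftrightarrow>
     (\<exists>\<epsilon> x0 y0 c Q. T = moebius_map \<epsilon> x0 y0 c Q \<and> c > 0 \<and> orthogonal_matrix Q \<and>
        (\<epsilon> = 0 \<and> det Q = 1 \<or> \<epsilon> = 2 \<and> det Q = -1))"

text \<open>
  The identification of \<open>real ^ 'n\<close> with a coordinate subspace of \<open>real ^ 'm\<close>, along an
  injection \<open>\<iota>\<close> of the coordinate indices.
\<close>

definition embed :: "('n::finite \<Rightarrow> 'm::finite) \<Rightarrow> real ^ 'n \<Rightarrow> real ^ 'm" where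
  "embed \<iota> x = (\<chi> j. if j \<in> range \<iota> then x $ inv \<iota> j else 0)"

definition moebius_restriction ::
  "('n::finite \<Rightarrow> 'm::finite) \<Rightarrow> (real ^ 'n) set \<Rightarrow> (real ^ 'n \<Rightarrow> real ^ 'm) \<Rightarrow> bool" where
  "moebius_restriction \<iota> \<Omega> F \<longleftrightarrow>
     (\<exists>T. moebius T \<and> (\<forall>x\<in>\<Omega>. T (Some (embed \<iota> x)) = Some (F x)))"

definition inner_moebius_curve ::
  "(real ^ 'n::finite) set \<Rightarrow> (real ^ 'n \<Rightarrow> real ^ 'm::finite) \<Rightarrow> bool" where
  "inner_moebius_curve \<Omega> F \<longleftrightarrow>
     (\<exists>y0 L g T. linear_isometry L \<and> moebius T \<and>
        (\<forall>x\<in>\<Omega>. T (Some x) = Some (g x) \<and> F x = y0 + L (g x)))"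

end

theory Submission
  imports Defs
begin

text \<open>
  A Moebius transformation of the sphere \<open>S^m\<close> that is affine restricts to an inner Moebius curve,
  and so does one that is an inversion centred at a point of \<open>real ^ 'n\<close>. If the centre \<open>x0\<close> lies off
  \<open>real ^ 'n\<close>, the image is contained in a round sphere, and the task is to show that \<open>\<omega>\<close> cannot
  calibrate it. The differential at \<open>x\<close> is a positive multiple of the reflection along
  \<open>w = x - x0 = u - k\<close>, with \<open>u\<close> in \<open>real ^ 'n\<close> and \<open>k\<close> orthogonal to it. Evaluating \<open>\<omega>\<close> on the
  reflected frame \<open>e\<close> gives \<open>a (|k|^2 - |u|^2) + 2 u \<bullet> b = |u|^2 + |k|^2\<close> on an open set of \<open>u\<close>, where
  \<open>a\<close> is the value of \<open>\<omega>\<close> on \<open>e\<close> and \<open>b\<close> collects its values on \<open>e\<close> with one vector replaced by \<open>k\<close>.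
  Comparing coefficients yields \<open>a = -1\<close> and \<open>b = 0\<close>, hence \<open>k = 0\<close>.

  Conversely, the linear part of an inner Moebius curve extends to an orthogonal map of \<open>real ^ 'm\<close>.
  If \<open>n < m\<close> its determinant can be adjusted in the complement; if \<open>n = m\<close> the same evaluation
  of \<open>\<omega>\<close> shows that it has the sign required of a Moebius transformation.

  The definition of a conformal curve only provides a weak differential; it agrees almost everywhere
  with the classical one by the fundamental lemma of the calculus of variations.
\<close>

section \<open>Smooth cutoff functions\<close>

text \<open>The product and chain rules leave undifferentiated factors in a derivative; the
  inductions below need these factors only at the lower order of smoothness obtained here.\<close>

lemma Ck_Suc_imp_Ck: "Ck (Suc k) f \<Longrightarrow> Ck k f"
proof (induction k arbitrary: f)
  case 0
  then show ?case by (simp add: differentiable_imp_continuous_on)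
next
  case (Suc k)
  then show ?case by simp
qed

lemma Ck_const: "Ck k (\<lambda>x. c)"
  by (induction k arbitrary: c) auto

lemma Ck_bounded_linear:
  assumes "bounded_linear f"
  shows "Ck k f"
proof (cases k)
  case 0
  then show ?thesis using assms by (simp add: linear_continuous_on)
next
  case (Suc k)
  have "frechet_derivative f (at x) = f" for x
    using assms bounded_linear_imp_has_derivative frechet_derivative_at by metis
  then show ?thesis
    using Suc assms by (simp add: Ck_const bounded_linear_imp_differentiable_on)
qed

lemma Ck_add:
  assumes "Ck k f" "Ck k g"
  shows "Ck k (\<lambda>x. f x + g x)"
  using assms
proof (induction k arbitrary: f g)
  case 0
  then show ?case by (simp add: continuous_on_add)
next
  case (Suc k)
  have "frechet_derivative (\<lambda>x. f x + g x) (at x) = (\<lambda>v. frechet_derivative f (at x) v + frechet_derivative g (at x) v)" for x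
  proof -
    have "(f has_derivative frechet_derivative f (at x)) (at x)"
      "(g has_derivative frechet_derivative g (at x)) (at x)"
      using Suc.prems by (auto simp: differentiable_on_def simp flip: frechet_derivative_works)
    from frechet_derivative_at[OF has_derivative_add[OF this]] show ?thesis
      by simp
  qed
  then show ?case
    using Suc by (simp add: differentiable_on_add)
qed

lemma Ck_mult:
  assumes "Ck k f" "Ck k g"
  shows "Ck k (\<lambda>x. f x * g x)"
  using assms
proof (induction k arbitrary: f g)
  case 0
  then show ?case by (simp add: continuous_on_mult)
next
  case (Suc k)
  have "frechet_derivative (\<lambda>x. f x * g x) (at x) = (\<lambda>v. f x * frechet_derivative g (at x) v + frechet_derivative f (at x) v * g x)" for x
  proof -
    have "(f has_derivative frechet_derivative f (at x)) (at x)"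
      "(g has_derivative frechet_derivative g (at x)) (at x)"
      using Suc.prems by (auto simp: differentiable_on_def simp flip: frechet_derivative_works)
    from frechet_derivative_at[OF has_derivative_mult[OF this]] show ?thesis
      by simp
  qed
  moreover have "Ck k f" "Ck k g"
    using Suc.prems Ck_Suc_imp_Ck by blast+
  ultimately show ?case
    using Suc by (simp add: differentiable_on_mult Ck_add)
qed

lemma Ck_prod:
  assumes "finite I" "\<And>i. i \<in> I \<Longrightarrow> Ck k (f i)"
  shows "Ck k (\<lambda>x. \<Prod>i\<in>I. f i x)"
  using assms by (induction I) (auto simp: Ck_const Ck_mult)

lemma has_derivative_compose_real:
  fixes f :: "real ^ 'n::finite \<Rightarrow> real"
  assumes "(g has_real_derivative d) (at (f x))" "f differentiable (at x)"
  shows "((\<lambda>x. g (f x)) has_derivative (\<lambda>v. d * frechet_derivative f (at x) v)) (at x)"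
proof -
  have "(f has_derivative frechet_derivative f (at x)) (at x)"
    using assms(2) frechet_derivative_works by blast
  moreover have "(g has_derivative (\<lambda>v. d * v)) (at (f x))"
    using assms(1) by (simp add: has_field_derivative_def)
  ultimately show ?thesis
    using has_derivative_compose by blast
qed

lemma Ck_exp:
  assumes "Ck k f"
  shows "Ck k (\<lambda>x. exp (f x))"
  using assms
proof (induction k)
  case 0
  then show ?case by (simp add: continuous_on_exp)
next
  case (Suc k)
  have D: "((\<lambda>x. exp (f x)) has_derivative (\<lambda>v. exp (f x) * frechet_derivative f (at x) v)) (at x)"
    for x
    using Suc.prems by (intro has_derivative_compose_real DERIV_exp)
      (simp add: differentiable_on_def)
  have "Ck k (\<lambda>x. exp (f x))"
    using Suc Ck_Suc_imp_Ck by blast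
  then show ?case
    using Suc.prems D frechet_derivative_at[OF D, symmetric]
    by (auto simp: Ck_mult differentiable_on_def differentiable_def)
qed

section \<open>The flat function exp(-1/t) and its derivatives\<close>

text \<open>
  The extra index makes the family closed under differentiation, so that smoothness can be proved by
  induction without computing higher derivatives.
\<close>

definition flat :: "nat \<Rightarrow> real \<Rightarrow> real" where
  "flat j t = (if t > 0 then inverse t ^ j * exp (- inverse t) else 0)"

lemma flat_pos_iff: "0 < flat j t \<longleftrightarrow> 0 < t"
  by (simp add: flat_def)

lemma flat_nonneg: "0 \<le> flat j t"
  by (simp add: flat_def)

text \<open>On the right, the substitution s = 1/t turns this into the decay of s^j exp(-s) at
  infinity; on the left the function is zero.\<close>

lemma flat_tendsto_0: "(flat j \<longlongrightarrow> 0) (at 0)"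
proof (rule filterlim_split_at)
  show "(flat j \<longlongrightarrow> 0) (at_left 0)"
    by (rule tendsto_eventually) (auto simp: flat_def eventually_at_filter)
  have "((\<lambda>t. (inverse t) ^ j / exp (inverse t)) \<longlongrightarrow> 0) (at_right (0::real))"
    by (rule filterlim_compose[OF tendsto_power_div_exp_0 filterlim_inverse_at_top_right])
  then show "(flat j \<longlongrightarrow> 0) (at_right 0)"
    by (rule Lim_transform_eventually)
      (auto simp: flat_def eventually_at_filter exp_minus divide_inverse)
qed

lemma DERIV_flat:
  "(flat j has_real_derivative flat (j + 2) t - real j * flat (Suc j) t) (at t)"
proof (cases t "0::real" rule: linorder_cases)
  case less
  have "((\<lambda>_. 0) has_real_derivative flat (j + 2) t - real j * flat (Suc j) t) (at t)"
    using less by (simp add: flat_def)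
  then show ?thesis
    by (rule has_field_derivative_transform_within_open[of _ _ _ "{..<0}"])
      (use less in \<open>auto simp: flat_def\<close>)
next
  case equal
  \<comment> \<open>For h different from 0 the difference quotient of \<open>flat j\<close> at 0 is
    \<open>flat (Suc j) h\<close>, so its limit is already known.\<close>
  have "((\<lambda>h. (flat j (0 + h) - flat j 0) / h) \<longlongrightarrow> 0) (at 0)"
    by (rule Lim_transform_eventually[OF flat_tendsto_0[of "Suc j"]])
      (auto simp: flat_def eventually_at_filter divide_inverse)
  then show ?thesis
    using equal by (simp add: DERIV_def flat_def)
next
  case greater
  have "((\<lambda>t. inverse t ^ j * exp (- inverse t)) has_real_derivative
      flat (j + 2) t - real j * flat (Suc j) t) (at t)"
  proof (rule DERIV_cong[OF DERIV_mult])
    show "((\<lambda>t. inverse t ^ j) has_real_derivative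
        real j * (- (inverse t ^ Suc (Suc 0)) * inverse t ^ (j - Suc 0))) (at t)"
      using DERIV_power[OF DERIV_inverse, of t j] greater by simp
    show "((\<lambda>t. exp (- inverse t)) has_real_derivative exp (- inverse t) * inverse t ^ Suc (Suc 0)) (at t)"
      using greater by (auto intro!: derivative_eq_intros)
  qed (use greater in \<open>cases j; simp add: flat_def algebra_simps\<close>)
  then show ?thesis
    by (rule has_field_derivative_transform_within_open[of _ _ _ "{0<..}"])
      (use greater in \<open>auto simp: flat_def\<close>)
qed

lemma Ck_flat:
  assumes "Ck k f"
  shows "Ck k (\<lambda>x. flat j (f x))"
  using assms
proof (induction k arbitrary: j)
  case 0
  have "continuous_on UNIV (flat j)"
    by (intro continuous_at_imp_continuous_on ballI DERIV_isCont[OF DERIV_flat])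
  then show ?case
    using 0 continuous_on_compose2[of UNIV "flat j" UNIV f] by simp
next
  case (Suc k)
  have D: "((\<lambda>x. flat j (f x)) has_derivative (\<lambda>v.
      (flat (j + 2) (f x) + (- real j) * flat (Suc j) (f x)) * frechet_derivative f (at x) v)) (at x)"
    for x
    using Suc.prems has_derivative_compose_real[OF DERIV_flat, of f x]
    by (simp add: differentiable_on_def)
  have "Ck k (\<lambda>x. flat j (f x))" for j
    using Suc Ck_Suc_imp_Ck by blast
  then have "Ck k (\<lambda>x. (flat (j + 2) (f x) + (- real j) * flat (Suc j) (f x)) *
      frechet_derivative f (at x) v)" for v
    using Suc.prems by (intro Ck_mult Ck_add Ck_const) auto
  then show ?case
    using Suc.prems D frechet_derivative_at[OF D, symmetric]
    by (auto simp: differentiable_on_def differentiable_def)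
qed

section \<open>Bump functions and cutoffs on boxes\<close>

definition bump :: "real ^ 'n \<Rightarrow> real ^ 'n \<Rightarrow> real ^ 'n::finite \<Rightarrow> real" where
  "bump a b x = (\<Prod>i\<in>UNIV. flat 0 (x $ i - a $ i) * flat 0 (b $ i - x $ i))"

lemma bump_nonneg: "0 \<le> bump a b x"
  by (simp add: bump_def prod_nonneg flat_nonneg)

lemma bump_pos_iff: "0 < bump a b x \<longleftrightarrow> x \<in> box a b"
proof
  assume "0 < bump a b x"
  moreover have "bump a b x = 0" if "flat 0 (x $ i - a $ i) * flat 0 (b $ i - x $ i) = 0" for i
    unfolding bump_def using that by (intro prod_zero) auto
  ultimately have "flat 0 (x $ i - a $ i) * flat 0 (b $ i - x $ i) \<noteq> 0" for i
    by (metis less_irrefl)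
  then have "0 < flat 0 (x $ i - a $ i)" "0 < flat 0 (b $ i - x $ i)" for i
    using flat_nonneg[of 0 "x $ i - a $ i"] flat_nonneg[of 0 "b $ i - x $ i"]
    by (simp_all add: order_less_le)
  then show "x \<in> box a b"
    by (simp add: flat_pos_iff mem_box_cart)
qed (auto simp: bump_def mem_box_cart flat_pos_iff intro!: prod_pos)

lemma Ck_bump: "Ck k (bump a b)"
proof -
  have "Ck k (\<lambda>x::real^'a. x $ i - a $ i)" "Ck k (\<lambda>x::real^'a. b $ i - x $ i)" for i
    using Ck_add[OF Ck_bounded_linear Ck_const, of "\<lambda>x::real^'a. x $ i" k "- (a $ i)"]
      Ck_add[OF Ck_bounded_linear Ck_const, of "\<lambda>x::real^'a. - (x $ i)" k "b $ i"]
    by (simp_all add: bounded_linear_vec_nth bounded_linear_minus)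
  then show ?thesis
    unfolding bump_def by (intro Ck_prod Ck_mult Ck_flat) auto
qed

text \<open>As k grows, the exponential tends to 0 exactly where the bump is positive. This yields
  smooth functions with values between 0 and 1 that converge pointwise to the indicator of the open
  box, as dominated convergence requires.\<close>

definition cutoff :: "real ^ 'n \<Rightarrow> real ^ 'n \<Rightarrow> nat \<Rightarrow> real ^ 'n::finite \<Rightarrow> real" where
  "cutoff a b k x = 1 - exp (- real k * bump a b x)"

lemma cutoff_bounds: "0 \<le> cutoff a b k x" "cutoff a b k x \<le> 1"
  by (simp_all add: cutoff_def bump_nonneg)

lemma cutoff_eq_0: "x \<notin> box a b \<Longrightarrow> cutoff a b k x = 0"
  using bump_pos_iff[of a b x] bump_nonneg[of a b x] by (simp add: cutoff_def)

lemma test_function_cutoff: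
  assumes "cbox a b \<subseteq> \<Omega>"
  shows "test_function \<Omega> (cutoff a b k)"
proof -
  have "Ck l (\<lambda>x. 1 + (-1) * exp (- real k * bump a b x))" for l
    by (intro Ck_add Ck_mult Ck_const Ck_exp Ck_bump)
  moreover have "{x. cutoff a b k x \<noteq> 0} \<subseteq> cbox a b"
    using cutoff_eq_0 box_subset_cbox by blast
  then have "closure {x. cutoff a b k x \<noteq> 0} \<subseteq> cbox a b"
    by (rule closure_minimal) (rule closed_cbox)
  moreover from this have "compact (closure {x. cutoff a b k x \<noteq> 0})"
    using bounded_subset[OF bounded_cbox] by (auto simp: compact_eq_bounded_closed)
  ultimately show ?thesis
    using assms by (auto simp: test_function_def cutoff_def[abs_def])
qed

lemma cutoff_tendsto: "(\<lambda>k. cutoff a b k x) \<longlonglongrightarrow> indicator (box a b) x"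
proof (cases "x \<in> box a b")
  case True
  then have "bump a b x > 0"
    by (simp add: bump_pos_iff)
  then have "(\<lambda>k. 1 - exp (- real k * bump a b x)) \<longlonglongrightarrow> 1"
    using tendsto_diff[OF tendsto_const[of 1] filterlim_compose[OF exp_at_bot, of "\<lambda>k. - real k * bump a b x"]]
      filterlim_tendsto_neg_mult_at_bot[OF tendsto_const, of "- bump a b x" real sequentially]
    by (simp add: filterlim_real_sequentially mult.commute)
  then show ?thesis
    using True by (simp add: cutoff_def)
qed (simp add: cutoff_eq_0)

section \<open>Weak and classical derivatives\<close>

text \<open>A countable cover by Borel sets of finite measure serves for the completion as well.
  Sigma-finiteness is what lets vanishing integrals over all measurable sets force a function to
  vanish almost everywhere.\<close>

lemma sigma_finite_lebesgue: "sigma_finite_measure (lebesgue :: 'a::euclidean_space measure)"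
proof
  obtain A :: "'a set set" where "countable A" "A \<subseteq> sets lborel" "\<Union>A = space lborel"
      "\<forall>a\<in>A. emeasure lborel a \<noteq> \<infinity>"
    using lborel.sigma_finite_countable by blast
  moreover from this have "\<forall>a\<in>A. emeasure lebesgue a \<noteq> \<infinity>"
    by (auto simp: emeasure_completion subset_iff)
  ultimately show "\<exists>A::'a set set. countable A \<and> A \<subseteq> sets lebesgue \<and> \<Union>A = space lebesgue \<and>
      (\<forall>a\<in>A. emeasure lebesgue a \<noteq> \<infinity>)"
    by (auto intro!: exI[of _ A])
qed

text \<open>Open boxes form an intersection-stable generator of the Borel sets, and the sets over
  which \<open>h\<close> integrates to 0 are closed under complements and countable disjoint unions.
  Hence all Borel sets, and up to null sets all Lebesgue sets, have this property.\<close>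

lemma AE_zero_if_box_integrals_zero:
  fixes h :: "'a::euclidean_space \<Rightarrow> 'b::euclidean_space"
  assumes h: "integrable lebesgue h"
    and box: "\<And>a b. (LINT x:box a b|lebesgue. h x) = 0"
  shows "AE x in lebesgue. h x = 0"
proof (rule sigma_finite_measure.density_zero[OF sigma_finite_lebesgue h])
  have int: "set_integrable lebesgue S h" if "S \<in> sets lebesgue" for S
    using h that by (simp add: set_integrable_def integrable_mult_indicator)
  \<comment> \<open>Complements require the integral over the whole space, which is an increasing
    union of boxes.\<close>
  have total: "(LINT x|lebesgue. h x) = 0"
  proof -
    define A where "A = (\<lambda>i::nat. box (- (real i *\<^sub>R One)) (real i *\<^sub>R One) :: 'a set)"
    have UN: "(\<Union>i. A i) = UNIV"
      unfolding A_def by (rule UN_box_eq_UNIV)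
    have "incseq A"
      unfolding A_def by (auto simp: incseq_def box_def)
    then have "(\<lambda>i. LINT x:A i|lebesgue. h x) \<longlonglongrightarrow> (LINT x:(\<Union>i. A i)|lebesgue. h x)"
      by (intro set_integral_cont_up) (auto simp: A_def intro!: int)
    then have "(\<lambda>i::nat. 0) \<longlonglongrightarrow> (LINT x:UNIV|lebesgue. h x)"
      unfolding UN unfolding A_def box .
    then show ?thesis
      by (simp add: LIMSEQ_const_iff set_lebesgue_integral_def)
  qed
  have borel: "(LINT x:S|lebesgue. h x) = 0" if "S \<in> sets borel" for S
  proof -
    have sb: "sigma_sets UNIV (range (\<lambda>(a, b). box a b)) = sets (borel :: 'a measure)"
      by (subst borel_eq_box) simp
    have "Int_stable (range (\<lambda>(a, b). box a b :: 'a set))"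
    proof (rule Int_stableI)
      fix A B :: "'a set"
      assume "A \<in> range (\<lambda>(a, b). box a b)" "B \<in> range (\<lambda>(a, b). box a b)"
      then obtain a b c d where "A = box a b" "B = box c d"
        by auto
      then obtain u v where "A \<inter> B = (\<lambda>(a, b). box a b) (u, v)"
        using box_Int_box[of a b c d] by auto
      then show "A \<inter> B \<in> range (\<lambda>(a, b). box a b)"
        by blast
    qed
    moreover have "range (\<lambda>(a, b). box a b) \<subseteq> Pow (UNIV :: 'a set)"
      by simp
    moreover have "S \<in> sigma_sets UNIV (range (\<lambda>(a, b). box a b))"
      using that sb by simp
    ultimately show ?thesis
    proof (induction rule: sigma_sets_induct_disjoint)
      case (basic A)
      then show ?case
        by (auto simp: box)
    next
      case empty
      show ?case
        by (simp add: set_lebesgue_integral_def)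
    next
      case (compl S)
      have S: "S \<in> sets lebesgue"
        using compl sb by simp
      have "(LINT x:UNIV - S|lebesgue. h x) = (LINT x|lebesgue. h x - indicator S x *\<^sub>R h x)"
        unfolding set_lebesgue_integral_def by (rule Bochner_Integration.integral_cong) (auto simp: indicator_def)
      also have "\<dots> = (LINT x|lebesgue. h x) - (LINT x:S|lebesgue. h x)"
        using h int[OF S] by (simp add: set_integrable_def set_lebesgue_integral_def)
      finally show ?case
        using total compl by simp
    next
      case (union S)
      have [measurable]: "S i \<in> sets lebesgue" for i
        using union sb by auto
      have "(LINT x:(\<Union>i. S i)|lebesgue. h x) = (\<Sum>i. LINT x:S i|lebesgue. h x)"
        using union by (intro lebesgue_integral_countable_add int) (auto simp: disjoint_family_on_def)
      moreover have "(LINT x:S i|lebesgue. h x) = 0" for i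
        using union by blast
      ultimately show ?case
        by simp
    qed
  qed
  fix A :: "'a set"
  assume "A \<in> sets lebesgue"
  \<comment> \<open>A Lebesgue set is a Borel set up to a subset of a null set, which does not
    affect the integral.\<close>
  then obtain S N N' where A: "A = S \<union> N" "N \<subseteq> N'" "N' \<in> null_sets lborel" "S \<in> sets lborel"
    by (rule sets_completionE)
  have "AE x in lebesgue. x \<notin> N'"
    using A AE_not_in[OF null_sets_completionI] by blast
  then have "AE x in lebesgue. indicator A x *\<^sub>R h x = indicator S x *\<^sub>R h x"
    by eventually_elim (use A in \<open>auto simp: indicator_def\<close>)
  then have "(LINT x:A|lebesgue. h x) = (LINT x:S|lebesgue. h x)"
    unfolding set_lebesgue_integral_def
    using int[OF \<open>A \<in> sets lebesgue\<close>] int[OF sets_completionI_sets[OF A(4)]]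
    by (intro integral_cong_AE borel_measurable_integrable) (simp_all only: set_integrable_def)
  then show "(LINT x:A|lebesgue. h x) = 0"
    using borel A(4) by simp
qed

text \<open>Testing against cutoffs and passing to the limit gives vanishing integrals over boxes
  whose closed box lies in \<open>\<Omega>\<close>, hence \<open>h = 0\<close> almost everywhere on
  each such closed box. Countably many of them cover \<open>\<Omega>\<close>.\<close>

lemma AE_zero_if_test_integrals_zero:
  fixes h :: "real ^ 'n::finite \<Rightarrow> 'b::euclidean_space"
  assumes "open \<Omega>"
    and int: "\<And>K. compact K \<Longrightarrow> K \<subseteq> \<Omega> \<Longrightarrow> integrable (lebesgue_on K) h"
    and test: "\<And>\<phi>. test_function \<Omega> \<phi> \<Longrightarrow> (LINT x|lebesgue_on \<Omega>. \<phi> x *\<^sub>R h x) = 0"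
  shows "AE x in lebesgue_on \<Omega>. h x = 0"
proof -
  have \<Omega>: "\<Omega> \<in> sets lebesgue"
    using \<open>open \<Omega>\<close> by simp
  have int_cbox: "integrable lebesgue (\<lambda>x. indicator (cbox a b) x *\<^sub>R h x)" if "cbox a b \<subseteq> \<Omega>" for a b
    using int[OF compact_cbox that] Lebesgue_Measure.integrable_restrict_UNIV[of "cbox a b" h]
    by (simp add: indicator_scaleR_eq_if)
  have box: "(LINT x:box a b|lebesgue. h x) = 0" if ab: "cbox a b \<subseteq> \<Omega>" for a b
  proof (rule LIMSEQ_unique)
    \<comment> \<open>Since the cutoff vanishes off the open box, \<open>h\<close> may be cut down
      to the closed box, where it is integrable; this supplies the dominating function.\<close>
    have eq: "cutoff a b k x *\<^sub>R (indicator (cbox a b) x *\<^sub>R h x) =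
        (if x \<in> \<Omega> then cutoff a b k x *\<^sub>R h x else 0)" for k x
      using ab box_subset_cbox[of a b]
      by (cases "x \<in> box a b") (auto simp: indicator_def cutoff_eq_0)
    have "(LINT x|lebesgue. cutoff a b k x *\<^sub>R (indicator (cbox a b) x *\<^sub>R h x)) = 0" for k
      unfolding eq Lebesgue_Measure.integral_restrict_UNIV[OF \<Omega>] using test test_function_cutoff[OF ab] by blast
    then show "(\<lambda>k. LINT x|lebesgue. cutoff a b k x *\<^sub>R (indicator (cbox a b) x *\<^sub>R h x)) \<longlonglongrightarrow> 0"
      by simp
    have cut: "cutoff a b k \<in> borel_measurable lebesgue" for k
    proof -
      have "Ck 0 (cutoff a b k)"
        using test_function_cutoff[of a b UNIV] by (auto simp: test_function_def)
      then show ?thesis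
        by (simp add: borel_measurable_continuous_onI measurable_completion)
    qed
    show "(\<lambda>k. LINT x|lebesgue. cutoff a b k x *\<^sub>R (indicator (cbox a b) x *\<^sub>R h x))
        \<longlonglongrightarrow> (LINT x:box a b|lebesgue. h x)"
      unfolding set_lebesgue_integral_def
    proof (rule integral_dominated_convergence[where w = "\<lambda>x. norm (indicator (cbox a b) x *\<^sub>R h x)"])
      have "box a b \<subseteq> cbox a b"
        by (rule box_subset_cbox)
      have "(\<lambda>k. cutoff a b k x *\<^sub>R (indicator (cbox a b) x *\<^sub>R h x))
          \<longlonglongrightarrow> indicator (box a b) x *\<^sub>R (indicator (cbox a b) x *\<^sub>R h x)" for x
        by (intro tendsto_scaleR cutoff_tendsto tendsto_const)
      moreover have "indicator (box a b) x *\<^sub>R (indicator (cbox a b) x *\<^sub>R h x) = indicator (box a b) x *\<^sub>R h x" for x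
        using box_subset_cbox[of a b] by (auto simp: indicator_def)
      ultimately have "(\<lambda>k. cutoff a b k x *\<^sub>R (indicator (cbox a b) x *\<^sub>R h x))
          \<longlonglongrightarrow> indicator (box a b) x *\<^sub>R h x" for x
        by metis
      then show "AE x in lebesgue. (\<lambda>k. cutoff a b k x *\<^sub>R (indicator (cbox a b) x *\<^sub>R h x))
          \<longlonglongrightarrow> indicator (box a b) x *\<^sub>R h x"
        by (rule AE_I2)
      show "AE x in lebesgue. norm (cutoff a b k x *\<^sub>R (indicator (cbox a b) x *\<^sub>R h x))
          \<le> norm (indicator (cbox a b) x *\<^sub>R h x)" for k
        using cutoff_bounds[of a b k] by (auto intro!: mult_left_le_one_le simp del: scaleR_scaleR)
      show "(\<lambda>x. cutoff a b k x *\<^sub>R (indicator (cbox a b) x *\<^sub>R h x)) \<in> borel_measurable lebesgue" for k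
        by (rule borel_measurable_scaleR[OF cut borel_measurable_integrable[OF int_cbox[OF ab]]])
      have "(\<lambda>x. indicator (box a b) x *\<^sub>R (indicator (cbox a b) x *\<^sub>R h x)) \<in> borel_measurable lebesgue"
        by (rule borel_measurable_scaleR[OF borel_measurable_indicator borel_measurable_integrable[OF int_cbox[OF ab]]])
          simp
      moreover have "(\<lambda>x. indicator (box a b) x *\<^sub>R (indicator (cbox a b) x *\<^sub>R h x)) = (\<lambda>x. indicator (box a b) x *\<^sub>R h x)"
        using \<open>box a b \<subseteq> cbox a b\<close> by (auto simp: indicator_def fun_eq_iff)
      ultimately show "(\<lambda>x. indicator (box a b) x *\<^sub>R h x) \<in> borel_measurable lebesgue"
        by metis
      show "integrable lebesgue (\<lambda>x. norm (indicator (cbox a b) x *\<^sub>R h x))"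
        using int_cbox[OF ab] by (rule integrable_norm)
    qed
  qed
  have cbox: "AE x in lebesgue. x \<in> cbox a b \<longrightarrow> h x = 0" if ab: "cbox a b \<subseteq> \<Omega>" for a b
  proof -
    \<comment> \<open>The part of \<open>box c d\<close> inside the closed box differs from the open
      box \<open>box u v\<close> only on the boundary of \<open>cbox a b\<close>, a null
      set.\<close>
    have bdry: "AE x in lebesgue. x \<notin> cbox a b - box a b"
      using AE_not_in negligible_frontier_interval negligible_iff_null_sets by blast
    have "AE x in lebesgue. indicator (cbox a b) x *\<^sub>R h x = 0"
    proof (rule AE_zero_if_box_integrals_zero[OF int_cbox[OF ab]])
      fix c d
      obtain u v where uv: "box a b \<inter> box c d = box u v"
        using box_Int_box[of a b c d] by blast
      have "AE x in lebesgue. indicator (box c d) x *\<^sub>R indicator (cbox a b) x *\<^sub>R h x = indicator (box u v) x *\<^sub>R h x"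
        using bdry by eventually_elim
          (use box_subset_cbox[of a b] in \<open>auto simp: indicator_def simp flip: uv\<close>)
      moreover have m: "(\<lambda>x. indicator S x *\<^sub>R indicator (cbox a b) x *\<^sub>R h x) \<in> borel_measurable lebesgue"
        if "S \<in> sets lebesgue" for S
        by (rule borel_measurable_scaleR[OF borel_measurable_indicator[OF that]
              borel_measurable_integrable[OF int_cbox[OF ab]]])
      moreover have "(\<lambda>x. indicator (box u v) x *\<^sub>R indicator (cbox a b) x *\<^sub>R h x) = (\<lambda>x. indicator (box u v) x *\<^sub>R h x)"
        using uv box_subset_cbox[of a b] by (auto simp: indicator_def fun_eq_iff)
      with m[of "box u v"] have "(\<lambda>x. indicator (box u v) x *\<^sub>R h x) \<in> borel_measurable lebesgue"
        by simp
      ultimately have "(LINT x:box c d|lebesgue. indicator (cbox a b) x *\<^sub>R h x) = (LINT x:box u v|lebesgue. h x)"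
        unfolding set_lebesgue_integral_def by (intro integral_cong_AE) auto
      also have "\<dots> = 0"
      proof (cases "box u v = {}")
        case False
        \<comment> \<open>A nonempty open box has the closed box as its closure, so the inclusion
          passes from \<open>box u v\<close> to \<open>cbox u v\<close>; for an empty box this
          argument fails.\<close>
        then have "cbox u v \<subseteq> cbox a b"
          using uv by (metis Int_lower1 closure_box closure_cbox closure_mono box_subset_cbox closure_minimal closed_cbox order_trans)
        then show ?thesis
          using ab box by blast
      qed (simp add: set_lebesgue_integral_def)
      finally show "(LINT x:box c d|lebesgue. indicator (cbox a b) x *\<^sub>R h x) = 0" .
    qed
    then show ?thesis
      by eventually_elim (auto simp: indicator_def)
  qed
  obtain \<D> where \<D>: "countable \<D>" "\<D> \<subseteq> Pow \<Omega>" "\<And>X. X \<in> \<D> \<Longrightarrow> \<exists>a b. X = cbox a b" "\<Union>\<D> = \<Omega>"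
    using open_countable_Union_open_cbox[OF \<open>open \<Omega>\<close>] by blast
  have "AE x in lebesgue. \<forall>X\<in>\<D>. x \<in> X \<longrightarrow> h x = 0"
  proof (intro AE_ball_countable' \<D>(1))
    fix X
    assume "X \<in> \<D>"
    with \<D>(2,3) obtain a b where "X = cbox a b" "cbox a b \<subseteq> \<Omega>"
      by (metis PowD subsetD)
    then show "AE x in lebesgue. x \<in> X \<longrightarrow> h x = 0"
      using cbox by simp
  qed
  then have "AE x in lebesgue. x \<in> \<Omega> \<longrightarrow> h x = 0"
    by eventually_elim (use \<D>(4) in blast)
  then show ?thesis
    using \<Omega> by (simp add: AE_restrict_space_iff)
qed

section \<open>Integration by parts against test functions\<close>

lemma integrable_lebesgue_on_continuous_compact:
  fixes f :: "'a::euclidean_space \<Rightarrow> 'b::euclidean_space"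
  assumes "compact K" "continuous_on K f"
  shows "integrable (lebesgue_on K) f"
proof -
  have "integrable lebesgue (\<lambda>x. indicator K x *\<^sub>R f x)"
    using borel_integrable_compact[OF assms]
    by (subst integrable_completion) (auto dest: borel_measurable_integrable)
  then show ?thesis
    using assms(1)
    by (simp add: indicator_scaleR_eq_if borel_compact flip: Lebesgue_Measure.integrable_restrict_UNIV)
qed

text \<open>
  By translation invariance of the Lebesgue measure, the integrals of the difference quotients vanish.
\<close>

lemma integral_directional_derivative_eq_0:
  fixes \<psi> :: "'a::euclidean_space \<Rightarrow> 'b::euclidean_space"
  assumes D: "\<And>x. (\<psi> has_derivative D x) (at x)"
    and cont: "continuous_on UNIV (\<lambda>x. D x v)"
    and "compact K" and supp: "\<And>x. x \<notin> K \<Longrightarrow> \<psi> x = 0"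
  shows "(LINT x|lborel. D x v) = 0"
proof -
  have cont_\<psi>: "continuous_on UNIV \<psi>"
    by (intro continuous_at_imp_continuous_on ballI has_derivative_continuous[OF D])
  \<comment> \<open>The derivative vanishes on the open complement of \<open>K\<close>, so a bound
    on the compact set \<open>K\<close> is a global one.\<close>
  have "D x v = 0" if "x \<notin> K" for x
  proof -
    have "open (- K)"
      using \<open>compact K\<close> by (simp add: compact_imp_closed open_Compl)
    then have "(\<psi> has_derivative (\<lambda>_. 0)) (at x)"
      using that supp by (intro has_derivative_transform_within_open[OF has_derivative_const[of 0], of "- K"]) auto
    then show ?thesis
      using D has_derivative_unique by metis
  qed
  moreover obtain M0 where "\<And>x. x \<in> K \<Longrightarrow> norm (D x v) \<le> M0"
    using compact_imp_bounded[OF compact_continuous_image[OF continuous_on_subset[OF cont] \<open>compact K\<close>]]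
    by (auto simp: bounded_iff)
  ultimately have "norm (D x v) \<le> max 0 M0" for x
    by (cases "x \<in> K") (auto simp: le_max_iff_disj)
  then obtain M where M: "\<And>x. norm (D x v) \<le> M"
    by blast
  \<comment> \<open>\<open>K'\<close> consists of the points whose segment in direction
    \<open>v\<close>, for parameters in [0,1], meets \<open>K\<close>; off \<open>K'\<close> all
    difference quotients below vanish.\<close>
  define K' where "K' = (\<lambda>(y, t). y - t *\<^sub>R v) ` (K \<times> {0..1})"
  have "compact K'"
    unfolding K'_def split_def using \<open>compact K\<close>
    by (intro compact_continuous_image compact_Times) (auto intro!: continuous_intros)
  define q where "q k x = real (Suc k) *\<^sub>R (\<psi> (x + (1 / real (Suc k)) *\<^sub>R v) - \<psi> x)" for k x
  have line: "((\<lambda>t. \<psi> (x + t *\<^sub>R v)) has_vector_derivative D (x + t *\<^sub>R v) v) (at t)" for x t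
  proof -
    have "((\<lambda>t. x + t *\<^sub>R v) has_derivative (\<lambda>s. s *\<^sub>R v)) (at t)"
      by (auto intro!: derivative_eq_intros)
    from has_derivative_compose[OF this D] show ?thesis
      using linear_cmul[OF has_derivative_linear[OF D]] by (simp add: has_vector_derivative_def)
  qed
  have bound: "norm (q k x) \<le> indicator K' x *\<^sub>R M" for k x
  proof (cases "x \<in> K'")
    case True
    let ?t = "1 / real (Suc k)"
    \<comment> \<open>The mean value inequality along the segment gives a bound uniform in
      \<open>k\<close>, which makes dominated convergence applicable.\<close>
    have "norm (\<psi> (x + ?t *\<^sub>R v) - \<psi> (x + 0 *\<^sub>R v)) \<le> M * ?t - M * 0"
    proof (rule differentiable_bound_general)
      show "0 < ?t"
        by simp
      show "continuous_on {0..?t} (\<lambda>t. \<psi> (x + t *\<^sub>R v))"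
        by (rule continuous_on_compose2[OF cont_\<psi>]) (auto intro!: continuous_intros)
      show "((*) M has_vector_derivative M) (at t)" for t
        by (auto intro!: derivative_eq_intros simp flip: has_real_derivative_iff_has_vector_derivative)
    qed (rule line M continuous_intros)+
    then have "real (Suc k) * norm (\<psi> (x + ?t *\<^sub>R v) - \<psi> x) \<le> M"
      by (simp add: pos_le_divide_eq mult.commute)
    then show ?thesis
      using True by (simp add: q_def)
  next
    case False
    have "x + t *\<^sub>R v \<notin> K" if "t \<in> {0..1}" for t
    proof
      assume "x + t *\<^sub>R v \<in> K"
      then have "(\<lambda>(y, t). y - t *\<^sub>R v) (x + t *\<^sub>R v, t) \<in> K'"
        unfolding K'_def using that by (intro imageI) auto
      then show False
        using False by simp
    qed
    from this[of "1 / real (Suc k)"] this[of 0] show ?thesis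
      using False supp by (simp add: q_def)
  qed
  have int_\<psi>: "integrable lborel \<psi>"
  proof -
    have "indicator K x *\<^sub>R \<psi> x = \<psi> x" for x
      using supp by (auto simp: indicator_def)
    then show ?thesis
      using borel_integrable_compact[OF \<open>compact K\<close> continuous_on_subset[OF cont_\<psi>]] by simp
  qed
  have shift: "integrable lborel (\<lambda>x. \<psi> (x + w))" "(LINT x|lborel. \<psi> (x + w)) = (LINT x|lborel. \<psi> x)" for w
  proof -
    show "integrable lborel (\<lambda>x. \<psi> (x + w))"
    proof -
      have "integrable (distr lborel borel ((+) w)) \<psi>"
        using int_\<psi> by (simp add: lborel_distr_plus)
      then show ?thesis
        using integrable_distr[of "(+) w" lborel borel \<psi>] by (simp add: add.commute)
    qed
    have "(LINT x|distr lborel borel ((+) w). \<psi> x) = (LINT x|lborel. \<psi> (w + x))"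
      using int_\<psi> by (intro integral_distr) auto
    then show "(LINT x|lborel. \<psi> (x + w)) = (LINT x|lborel. \<psi> x)"
      by (simp add: lborel_distr_plus add.commute)
  qed
  have int_q: "(LINT x|lborel. q k x) = 0" for k
    using shift int_\<psi> unfolding q_def by simp
  have "(\<lambda>k. LINT x|lborel. q k x) \<longlonglongrightarrow> (LINT x|lborel. D x v)"
  proof (rule integral_dominated_convergence[where w = "\<lambda>x. indicator K' x *\<^sub>R M"])
    show "(\<lambda>x. D x v) \<in> borel_measurable lborel"
      using cont by (simp add: borel_measurable_continuous_onI)
    show "q k \<in> borel_measurable lborel" for k
      unfolding q_def using shift(1) int_\<psi> by (auto intro!: borel_measurable_scaleR borel_measurable_diff)
    show "integrable lborel (\<lambda>x. indicator K' x *\<^sub>R M)"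
      by (rule borel_integrable_compact[OF \<open>compact K'\<close> continuous_on_const])
    show "AE x in lborel. norm (q k x) \<le> indicator K' x *\<^sub>R M" for k
      by (rule AE_I2) (rule bound)
    have "(\<lambda>k. q k x) \<longlonglongrightarrow> D x v" for x
    proof -
      have "((\<lambda>t. norm (\<psi> (x + t *\<^sub>R v) - \<psi> x - t *\<^sub>R D x v) / norm t) \<longlongrightarrow> 0) (at 0)"
        using line[of x 0] unfolding has_vector_derivative_def has_derivative_at by simp
      then have "((\<lambda>t. norm ((\<psi> (x + t *\<^sub>R v) - \<psi> x) /\<^sub>R t - D x v)) \<longlongrightarrow> 0) (at 0)"
      proof (rule Lim_transform_eventually)
        have "norm (\<psi> (x + t *\<^sub>R v) - \<psi> x - t *\<^sub>R D x v) / norm t =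
            norm ((\<psi> (x + t *\<^sub>R v) - \<psi> x) /\<^sub>R t - D x v)" if "t \<noteq> 0" for t
        proof -
          have "(\<psi> (x + t *\<^sub>R v) - \<psi> x) /\<^sub>R t - D x v = (\<psi> (x + t *\<^sub>R v) - \<psi> x - t *\<^sub>R D x v) /\<^sub>R t"
            using that by (simp add: scaleR_diff_right)
          then show ?thesis
            by (simp add: divide_inverse mult.commute)
        qed
        then show "\<forall>\<^sub>F t in at 0. norm (\<psi> (x + t *\<^sub>R v) - \<psi> x - t *\<^sub>R D x v) / norm t =
            norm ((\<psi> (x + t *\<^sub>R v) - \<psi> x) /\<^sub>R t - D x v)"
          by (simp add: eventually_at_filter)
      qed
      then have lim: "((\<lambda>t. (\<psi> (x + t *\<^sub>R v) - \<psi> x) /\<^sub>R t) \<longlongrightarrow> D x v) (at 0)"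
        using Lim_null tendsto_norm_zero_iff by blast
      have "filterlim (\<lambda>k. 1 / real (Suc k)) (at 0) sequentially"
        using LIMSEQ_Suc[OF lim_1_over_n] by (auto simp: filterlim_at simp del: of_nat_Suc)
      from filterlim_compose[OF lim this] show ?thesis
        by (simp add: q_def del: of_nat_Suc)
    qed
    then show "AE x in lborel. (\<lambda>k. q k x) \<longlonglongrightarrow> D x v"
      by simp
  qed
  then show ?thesis
    by (simp add: int_q LIMSEQ_const_iff)
qed

text \<open>A continuous factor is bounded on \<open>K\<close> and the product vanishes elsewhere,
  so local integrability of \<open>g\<close> suffices.\<close>

lemma integrable_scaleR_compact_support:
  fixes g :: "'a::euclidean_space \<Rightarrow> 'b::euclidean_space"
  assumes \<Omega>: "\<Omega> \<in> sets lebesgue" and K: "compact K" "K \<subseteq> \<Omega>"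
    and g: "integrable (lebesgue_on K) g"
    and \<phi>: "continuous_on UNIV \<phi>" "\<And>x. x \<notin> K \<Longrightarrow> \<phi> x = 0"
  shows "integrable (lebesgue_on \<Omega>) (\<lambda>x. \<phi> x *\<^sub>R g x)"
proof -
  let ?g = "\<lambda>x. if x \<in> K then g x else 0"
  have g': "integrable lebesgue ?g"
    using g K(1) by (simp add: Lebesgue_Measure.integrable_restrict_UNIV borel_compact)
  obtain M where "\<And>x. x \<in> K \<Longrightarrow> \<bar>\<phi> x\<bar> \<le> M"
    using compact_imp_bounded[OF compact_continuous_image[OF continuous_on_subset[OF \<phi>(1)] K(1)]]
    by (auto simp: bounded_iff)
  then have M: "norm (\<phi> x *\<^sub>R ?g x) \<le> norm (M *\<^sub>R norm (?g x))" for x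
    by (auto intro!: mult_right_mono order_trans[OF _ abs_ge_self])
  have "integrable lebesgue (\<lambda>x. \<phi> x *\<^sub>R ?g x)"
  proof (rule Bochner_Integration.integrable_bound[OF _ _ AE_I2[OF M]])
    show "integrable lebesgue (\<lambda>x. M *\<^sub>R norm (?g x))"
      by (intro integrable_scaleR_right integrable_norm g')
    have "\<phi> \<in> borel_measurable lebesgue"
      using \<phi>(1) by (simp add: borel_measurable_continuous_onI measurable_completion)
    then show "(\<lambda>x. \<phi> x *\<^sub>R ?g x) \<in> borel_measurable lebesgue"
      by (rule borel_measurable_scaleR[OF _ borel_measurable_integrable[OF g']])
  qed
  moreover have "(\<lambda>x. \<phi> x *\<^sub>R ?g x) = (\<lambda>x. if x \<in> \<Omega> then \<phi> x *\<^sub>R g x else 0)"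
    using K(2) \<phi>(2) by (auto simp: fun_eq_iff)
  ultimately show ?thesis
    using \<Omega> by (simp flip: Lebesgue_Measure.integrable_restrict_UNIV)
qed

text \<open>The support is closed, so near any point outside it the function is identically zero and
  its derivative vanishes too. One compact set therefore serves both terms of the product
  rule.\<close>

lemma test_functionE:
  assumes "test_function \<Omega> \<phi>"
  obtains K where "compact K" "K \<subseteq> \<Omega>" "\<And>x. x \<notin> K \<Longrightarrow> \<phi> x = 0"
    "continuous_on UNIV \<phi>" "\<And>v. continuous_on UNIV (\<lambda>x. frechet_derivative \<phi> (at x) v)"
    "\<And>x. (\<phi> has_derivative frechet_derivative \<phi> (at x)) (at x)"
    "\<And>x v. x \<notin> K \<Longrightarrow> frechet_derivative \<phi> (at x) v = 0"
proof
  let ?K = "closure {x. \<phi> x \<noteq> 0}"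
  have "Ck 0 \<phi>" and C1: "Ck (Suc 0) \<phi>"
    using assms by (auto simp: test_function_def simp del: Ck.simps)
  then show "continuous_on UNIV \<phi>" "continuous_on UNIV (\<lambda>x. frechet_derivative \<phi> (at x) v)" for v
    by auto
  show "compact ?K" "?K \<subseteq> \<Omega>"
    using assms by (auto simp: test_function_def)
  show K: "\<phi> x = 0" if "x \<notin> ?K" for x
    using that closure_subset[of "{x. \<phi> x \<noteq> 0}"] by auto
  show D: "(\<phi> has_derivative frechet_derivative \<phi> (at x)) (at x)" for x
    using C1 by (auto simp: differentiable_on_def simp flip: frechet_derivative_works)
  show "frechet_derivative \<phi> (at x) v = 0" if "x \<notin> ?K" for x v
  proof -
    have "open (- ?K)"
      by (rule open_Compl[OF closed_closure])
    then have "(\<phi> has_derivative (\<lambda>_. 0)) (at x)"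
      by (rule has_derivative_transform_within_open[OF has_derivative_const[of 0]])
        (simp_all only: Compl_iff K that not_False_eq_True)
    from has_derivative_unique[OF D this] show ?thesis
      by simp
  qed
qed

text \<open>The product of \<open>\<phi>\<close> and \<open>F\<close>, extended by zero, has compact
  support, so the integral of its directional derivative vanishes; the product rule splits that
  integral into the two terms.\<close>

lemma integral_by_parts_test_function:
  fixes F :: "real ^ 'n::finite \<Rightarrow> 'b::euclidean_space"
  assumes "open \<Omega>" and \<phi>: "test_function \<Omega> \<phi>"
    and D: "\<And>x. x \<in> \<Omega> \<Longrightarrow> (F has_derivative D x) (at x)"
    and cont: "continuous_on \<Omega> (\<lambda>x. D x v)"
  shows "(LINT x|lebesgue_on \<Omega>. frechet_derivative \<phi> (at x) v *\<^sub>R F x) =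
    - (LINT x|lebesgue_on \<Omega>. \<phi> x *\<^sub>R D x v)"
proof -
  obtain K where K: "compact K" "K \<subseteq> \<Omega>" "\<And>x. x \<notin> K \<Longrightarrow> \<phi> x = 0"
    and cont_\<phi>: "continuous_on UNIV \<phi>"
      "continuous_on UNIV (\<lambda>x. frechet_derivative \<phi> (at x) v)"
    and D\<phi>: "\<And>x. (\<phi> has_derivative frechet_derivative \<phi> (at x)) (at x)"
      "\<And>x v. x \<notin> K \<Longrightarrow> frechet_derivative \<phi> (at x) v = 0"
    using test_functionE[OF \<phi>] by metis
  have cont_F: "continuous_on \<Omega> F"
    by (intro continuous_at_imp_continuous_on ballI has_derivative_continuous[OF D])
  have \<Omega>: "\<Omega> \<in> sets lebesgue"
    using \<open>open \<Omega>\<close> by simp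
  have open_K: "open (- K)"
    using K(1) by (simp add: compact_imp_closed open_Compl)
  define \<psi> where "\<psi> x = (if x \<in> \<Omega> then \<phi> x *\<^sub>R F x else 0)" for x
  define E where "E x h = (if x \<in> \<Omega> then \<phi> x *\<^sub>R D x h + frechet_derivative \<phi> (at x) h *\<^sub>R F x else 0)" for x h
  have DE: "(\<psi> has_derivative E x) (at x)" for x
  proof (cases "x \<in> \<Omega>")
    case True
    have "((\<lambda>x. \<phi> x *\<^sub>R F x) has_derivative E x) (at x)"
      using has_derivative_scaleR[OF D\<phi>(1) D[OF True]] True by (simp add: E_def[abs_def])
    then show ?thesis
      using \<open>open \<Omega>\<close> True by (rule has_derivative_transform_within_open) (simp add: \<psi>_def)
  next
    case False
    have "(\<psi> has_derivative (\<lambda>_. 0)) (at x)"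
      using False K open_K
      by (intro has_derivative_transform_within_open[OF has_derivative_const[of 0], of "- K"])
        (auto simp: \<psi>_def)
    then show ?thesis
      using False by (simp add: E_def[abs_def])
  qed
  \<comment> \<open>Continuity is checked on two open sets covering the space: the product formula
    applies on \<open>\<Omega>\<close>, and the derivative is zero off \<open>K\<close>.\<close>
  have "continuous_on (\<Omega> \<union> - K) (\<lambda>x. E x v)"
  proof (rule continuous_on_open_Un[OF \<open>open \<Omega>\<close> open_K])
    have "continuous_on \<Omega> (\<lambda>x. \<phi> x *\<^sub>R D x v + frechet_derivative \<phi> (at x) v *\<^sub>R F x)"
      by (intro continuous_intros cont cont_F continuous_on_subset[OF cont_\<phi>(1)]
          continuous_on_subset[OF cont_\<phi>(2)]) auto
    then show "continuous_on \<Omega> (\<lambda>x. E x v)"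
      by (rule continuous_on_eq) (simp add: E_def)
    show "continuous_on (- K) (\<lambda>x. E x v)"
      by (rule continuous_on_eq[OF continuous_on_const[of _ 0]]) (simp add: E_def K D\<phi>)
  qed
  moreover have "\<Omega> \<union> - K = UNIV"
    using K(2) by blast
  ultimately have cont_E: "continuous_on UNIV (\<lambda>x. E x v)"
    by simp
  have "(LINT x|lborel. E x v) = 0"
    by (rule integral_directional_derivative_eq_0[OF DE cont_E K(1)]) (simp add: \<psi>_def K)
  then have "(LINT x|lebesgue. E x v) = 0"
    using cont_E by (simp add: integral_completion borel_measurable_continuous_onI)
  then have "(LINT x|lebesgue_on \<Omega>. \<phi> x *\<^sub>R D x v + frechet_derivative \<phi> (at x) v *\<^sub>R F x) = 0"
    unfolding E_def by (simp add: Lebesgue_Measure.integral_restrict_UNIV[OF \<Omega>])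
  moreover have "integrable (lebesgue_on \<Omega>) (\<lambda>x. \<phi> x *\<^sub>R D x v)"
    by (intro integrable_scaleR_compact_support[OF \<Omega> K(1,2)] cont_\<phi> K
        integrable_lebesgue_on_continuous_compact continuous_on_subset[OF cont])
  moreover have "integrable (lebesgue_on \<Omega>) (\<lambda>x. frechet_derivative \<phi> (at x) v *\<^sub>R F x)"
    by (intro integrable_scaleR_compact_support[OF \<Omega> K(1,2)] cont_\<phi> D\<phi>(2) K(1,2)
        integrable_lebesgue_on_continuous_compact continuous_on_subset[OF cont_F])
  ultimately show ?thesis
    by (simp add: add_eq_0_iff)
qed

section \<open>Identification of weak and classical derivatives\<close>

text \<open>On a compact set constants are integrable, and t \<le> 1 + t^p for t \<ge> 0 and p \<ge>
  1.\<close>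

lemma Lp_loc_imp_integrable:
  assumes "Lp_loc p \<Omega> f" "1 \<le> p" "compact K" "K \<subseteq> \<Omega>"
  shows "integrable (lebesgue_on K) f"
proof (rule Bochner_Integration.integrable_bound)
  show "f \<in> borel_measurable (lebesgue_on K)"
    by (rule measurable_restrict_mono[of f lebesgue \<Omega>]) (use assms in \<open>simp_all add: Lp_loc_def\<close>)
  have "integrable (lebesgue_on K) (\<lambda>x. 1 :: real)"
    using assms by (intro integrable_lebesgue_on_continuous_compact) auto
  then show "integrable (lebesgue_on K) (\<lambda>x. 1 + norm (f x) ^ p)"
    using assms by (auto simp: Lp_loc_def)
  have "norm (f x) \<le> 1 + norm (f x) ^ p" for x
  proof (cases "norm (f x) \<le> 1")
    case False
    then show ?thesis
      using self_le_power[of "norm (f x)" p] assms(2) by simp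
  qed (simp add: add_increasing2)
  then show "AE x in lebesgue_on K. norm (f x) \<le> norm (1 + norm (f x) ^ p)"
    by (intro AE_I2) (auto intro: order_trans[OF _ abs_ge_self])
qed

text \<open>Both derivatives satisfy the same integration by parts formula, so each column of their
  difference integrates to 0 against every test function and the fundamental lemma applies. The
  finitely many columns are then combined.\<close>

lemma weak_derivative_eq_derivative:
  fixes F :: "real ^ 'n::finite \<Rightarrow> real ^ 'm::finite"
  assumes "open \<Omega>" and FG: "W1_loc p \<Omega> F G" "1 \<le> p"
    and D: "\<And>x. x \<in> \<Omega> \<Longrightarrow> (F has_derivative D x) (at x)"
    and cont: "\<And>v. continuous_on \<Omega> (\<lambda>x. D x v)"
  shows "AE x in lebesgue_on \<Omega>. (\<lambda>v. G x *v v) = D x"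
proof -
  have \<Omega>: "\<Omega> \<in> sets lebesgue"
    using \<open>open \<Omega>\<close> by simp
  have int_G: "integrable (lebesgue_on K) (\<lambda>x. column i (G x))" if "compact K" "K \<subseteq> \<Omega>" for K i
  proof -
    have "bounded_linear (\<lambda>A :: real ^ 'n ^ 'm. column i A)"
      unfolding linear_conv_bounded_linear[symmetric]
      by (intro linearI) (simp_all add: column_def vec_eq_iff)
    then show ?thesis
      using integrable_bounded_linear Lp_loc_imp_integrable[OF _ FG(2) that] FG(1)
      by (metis W1_loc_def)
  qed
  have int_D: "integrable (lebesgue_on K) (\<lambda>x. D x v)" if "compact K" "K \<subseteq> \<Omega>" for K v
    using that by (intro integrable_lebesgue_on_continuous_compact continuous_on_subset[OF cont])
  have "AE x in lebesgue_on \<Omega>. column i (G x) - D x (axis i 1) = 0" for i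
  proof (rule AE_zero_if_test_integrals_zero[OF \<open>open \<Omega>\<close>])
    show "integrable (lebesgue_on K) (\<lambda>x. column i (G x) - D x (axis i 1))"
      if "compact K" "K \<subseteq> \<Omega>" for K
      using int_G[OF that] int_D[OF that] by (rule Bochner_Integration.integrable_diff)
    fix \<phi> assume \<phi>: "test_function \<Omega> \<phi>"
    obtain K where K: "compact K" "K \<subseteq> \<Omega>" "continuous_on UNIV \<phi>" "\<And>x. x \<notin> K \<Longrightarrow> \<phi> x = 0"
    proof (rule test_functionE[OF \<phi>])
      fix K assume "compact K" "K \<subseteq> \<Omega>" "\<And>x. x \<notin> K \<Longrightarrow> \<phi> x = 0" "continuous_on UNIV \<phi>"
      then show thesis
        using that by simp
    qed
    have "(LINT x|lebesgue_on \<Omega>. \<phi> x *\<^sub>R column i (G x)) = (LINT x|lebesgue_on \<Omega>. \<phi> x *\<^sub>R D x (axis i 1))"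
    proof -
      have "(LINT x|lebesgue_on \<Omega>. frechet_derivative \<phi> (at x) (axis i 1) *\<^sub>R F x) =
          - (LINT x|lebesgue_on \<Omega>. \<phi> x *\<^sub>R column i (G x))"
        using FG(1) \<phi> by (simp add: W1_loc_def weak_derivative_def)
      with integral_by_parts_test_function[OF \<open>open \<Omega>\<close> \<phi> D cont, of "axis i 1"] show ?thesis
        by simp
    qed
    moreover have "integrable (lebesgue_on \<Omega>) (\<lambda>x. \<phi> x *\<^sub>R column i (G x))"
      by (rule integrable_scaleR_compact_support[OF \<Omega> K(1,2) int_G[OF K(1,2)] K(3,4)])
    moreover have "integrable (lebesgue_on \<Omega>) (\<lambda>x. \<phi> x *\<^sub>R D x (axis i 1))"
      by (rule integrable_scaleR_compact_support[OF \<Omega> K(1,2) int_D[OF K(1,2)] K(3,4)])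
    ultimately show "(LINT x|lebesgue_on \<Omega>. \<phi> x *\<^sub>R (column i (G x) - D x (axis i 1))) = 0"
      by (simp add: scaleR_diff_right)
  qed
  then have "AE x in lebesgue_on \<Omega>. \<forall>i. column i (G x) - D x (axis i 1) = 0"
    by (simp add: AE_all_countable)
  moreover have "AE x in lebesgue_on \<Omega>. x \<in> \<Omega>"
    using AE_space[of "lebesgue_on \<Omega>"] by simp
  ultimately show ?thesis
  proof eventually_elim
    case (elim x)
    have "matrix (D x) = G x"
      using elim(1) by (simp add: matrix_def column_def vec_eq_iff)
    then show ?case
      using matrix_vector_mul(2)[OF has_derivative_linear[OF D[OF elim(2)]]] by simp
  qed
qed

text \<open>The set where \<open>q\<close> is nonzero is open, and a nonempty open set is not
  negligible. This turns the almost-everywhere identities for conformal curves into pointwise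
  ones.\<close>

lemma continuous_AE_zero_imp_zero:
  fixes q :: "'a::euclidean_space \<Rightarrow> real"
  assumes "open \<Omega>" "continuous_on \<Omega> q" "AE x in lebesgue_on \<Omega>. q x = 0" "x \<in> \<Omega>"
  shows "q x = 0"
proof (rule ccontr)
  assume "q x \<noteq> 0"
  let ?U = "\<Omega> \<inter> q -` (- {0})"
  have "AE x in lebesgue. x \<notin> ?U"
    using assms(1,3) by (simp add: AE_restrict_space_iff)
  moreover have "open ?U"
    using assms(1,2) by (intro continuous_open_preimage) auto
  ultimately have "negligible ?U"
    by (simp add: negligible_iff_null_sets AE_iff_null_sets)
  then show False
    using \<open>open ?U\<close> open_not_negligible \<open>x \<in> \<Omega>\<close> \<open>q x \<noteq> 0\<close> by blast
qed

section \<open>Covectors and linear isometries\<close>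

lemma covector_linear: "covector \<omega> \<Longrightarrow> linear (\<lambda>x. \<omega> (v(i := x)))"
  by (simp add: covector_def)

lemma covector_repeat: "covector \<omega> \<Longrightarrow> i \<noteq> j \<Longrightarrow> v i = v j \<Longrightarrow> \<omega> v = 0"
  unfolding covector_def by blast

lemma covector_compose_linear:
  fixes \<omega> :: "('n::finite \<Rightarrow> real ^ 'm::finite) \<Rightarrow> real" and P :: "real ^ 'm \<Rightarrow> real ^ 'm"
  assumes "covector \<omega>" "linear P"
  shows "covector (\<lambda>v. \<omega> (P \<circ> v))"
  unfolding covector_def
proof (intro conjI allI impI)
  fix i and v :: "'n \<Rightarrow> real ^ 'm"
  show "linear (\<lambda>x. \<omega> (P \<circ> v(i := x)))"
  proof -
    have "P \<circ> v(i := x) = (P \<circ> v)(i := P x)" for x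
      by auto
    then show ?thesis
      using linear_compose[OF assms(2) covector_linear[OF assms(1), of "P \<circ> v" i]] by (simp add: o_def)
  qed
next
  fix v :: "'n \<Rightarrow> real ^ 'm" and i j
  assume "i \<noteq> j \<and> v i = v j"
  then show "\<omega> (P \<circ> v) = 0"
    using covector_repeat[OF assms(1), of i j] by simp
qed

lemma covector_shear_at:
  assumes "covector \<omega>"
  shows "\<omega> (f(j := x - t *\<^sub>R y)) = \<omega> (f(j := x)) - t * \<omega> (f(j := y))"
  using linear_diff[OF covector_linear[OF assms]] linear_cmul[OF covector_linear[OF assms]] by simp

text \<open>Each subtraction contributes a term with \<open>v k\<close> in two slots, which
  vanishes. As \<open>k\<close> is not in \<open>S\<close>, slot \<open>k\<close> itself stays
  unchanged throughout.\<close>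

lemma covector_add_multiples:
  assumes "covector \<omega>" "finite S" "k \<notin> S"
  shows "\<omega> (\<lambda>i. if i \<in> S then v i - t i *\<^sub>R v k else v i) = \<omega> v"
  using assms(2,3)
proof (induction S)
  case (insert j S)
  let ?f = "\<lambda>i. if i \<in> S then v i - t i *\<^sub>R v k else v i"
  have "(\<lambda>i. if i \<in> insert j S then v i - t i *\<^sub>R v k else v i) = ?f(j := v j - t j *\<^sub>R v k)"
    by auto
  moreover have "?f(j := v j) = ?f"
    using insert by auto
  moreover have "\<omega> (?f(j := v k)) = 0"
    using insert by (intro covector_repeat[OF assms(1), of j k]) auto
  ultimately show ?case
    using insert by (simp add: covector_shear_at[OF assms(1)])
qed simp

text \<open>In the multilinear expansion every term with \<open>w\<close> in two slots vanishes, so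
  only the terms of order at most one in \<open>t\<close> remain. A reflection changes a frame in
  exactly this way.\<close>

lemma covector_rank_one_update:
  assumes "covector \<omega>"
  shows "\<omega> (\<lambda>i. v i - t i *\<^sub>R w) = \<omega> v - (\<Sum>i\<in>UNIV. t i * \<omega> (v(i := w)))"
proof -
  have "\<omega> (\<lambda>i. if i \<in> S then v i - t i *\<^sub>R w else v i) = \<omega> v - (\<Sum>i\<in>S. t i * \<omega> (v(i := w)))"
    if "finite S" for S
    using that
  proof (induction S)
    case (insert j S)
    let ?f = "\<lambda>i. if i \<in> S then v i - t i *\<^sub>R w else v i"
    have "(\<lambda>i. if i \<in> insert j S then v i - t i *\<^sub>R w else v i) = ?f(j := v j - t j *\<^sub>R w)"
      by auto
    then have "\<omega> (\<lambda>i. if i \<in> insert j S then v i - t i *\<^sub>R w else v i) =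
        \<omega> (?f(j := v j)) - t j * \<omega> (?f(j := w))"
      by (simp only: covector_shear_at[OF assms])
    moreover have "?f(j := v j) = ?f"
      using insert by auto
    \<comment> \<open>With \<open>w\<close> already in slot \<open>j\<close>, the earlier
      modifications subtract multiples of the vector in that slot and can be undone.\<close>
    moreover have "\<omega> (?f(j := w)) = \<omega> (v(j := w))"
    proof -
      have "?f(j := w) = (\<lambda>i. if i \<in> S then (v(j := w)) i - t i *\<^sub>R (v(j := w)) j else (v(j := w)) i)"
        using insert by auto
      then show ?thesis
        by (simp only: covector_add_multiples[OF assms insert(1,2), of "v(j := w)" t])
    qed
    ultimately show ?case
      using insert by (simp only: sum.insert) (simp add: fun_upd_def)
  qed simp
  from this[of UNIV] show ?thesis
    by simp
qed

section \<open>The coordinate embedding and linear isometries\<close>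

lemma embed_axis: "inj \<iota> \<Longrightarrow> embed \<iota> (axis i 1) = axis (\<iota> i) 1"
  by (auto simp: embed_def vec_eq_iff axis_def)

lemma linear_embed: "linear (embed \<iota>)"
  by (intro linearI) (auto simp: embed_def vec_eq_iff)

lemma embed_nth: "inj \<iota> \<Longrightarrow> embed \<iota> x $ \<iota> i = x $ i"
  by (simp add: embed_def)

text \<open>The adjoint of the embedding reads off the coordinates along
  \<open>\<iota>\<close>.\<close>

lemma inner_embed:
  assumes "inj \<iota>"
  shows "z \<bullet> embed \<iota> x = (\<chi> i. z $ \<iota> i) \<bullet> x"
proof -
  have "z \<bullet> embed \<iota> x = (\<Sum>j\<in>UNIV. if j \<in> range \<iota> then z $ j * x $ inv \<iota> j else 0)"
    by (auto simp: inner_vec_def embed_def intro!: sum.cong)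
  also have "\<dots> = (\<Sum>j\<in>range \<iota>. z $ j * x $ inv \<iota> j)"
    by (simp add: sum.If_cases)
  also have "\<dots> = (\<chi> i. z $ \<iota> i) \<bullet> x"
    using assms by (simp add: sum.reindex inner_vec_def)
  finally show ?thesis .
qed

lemma inner_embed_embed: "inj \<iota> \<Longrightarrow> embed \<iota> x \<bullet> embed \<iota> y = x \<bullet> y"
  by (simp add: inner_embed embed_nth)

lemma linear_isometry_embed: "inj \<iota> \<Longrightarrow> linear_isometry (embed \<iota>)"
  by (simp add: linear_isometry_def linear_embed norm_eq_sqrt_inner inner_embed_embed)

lemma linear_isometry_compose:
  "linear_isometry f \<Longrightarrow> linear_isometry g \<Longrightarrow> linear_isometry (\<lambda>x. f (g x))"
  using linear_compose[of g f] by (simp add: linear_isometry_def o_def)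

lemma linear_isometry_orthogonal_matrix:
  assumes "orthogonal_matrix Q"
  shows "linear_isometry ((*v) Q)"
proof -
  have "orthogonal_transformation ((*v) Q)"
    using assms by (simp add: orthogonal_transformation_matrix)
  then show ?thesis
    by (simp add: linear_isometry_def orthogonal_transformation)
qed

section \<open>Reflections, inversions and conformal differentials\<close>

text \<open>The reflection in the hyperplane orthogonal to \<open>w\<close>. Division by zero gives
  zero, so for \<open>w = 0\<close> this is the identity, again an isometry.\<close>

definition reflection :: "'a::real_inner \<Rightarrow> 'a \<Rightarrow> 'a" where
  "reflection w h = h - (2 * (w \<bullet> h) / (w \<bullet> w)) *\<^sub>R w"

lemma linear_reflection: "linear (reflection w)"
  by (intro linearI) (auto simp: reflection_def algebra_simps inner_add_right add_divide_distrib)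

lemma norm_reflection: "norm (reflection w h) = norm h"
  by (cases "w = 0")
    (auto simp: reflection_def norm_eq_sqrt_inner inner_diff_left inner_diff_right inner_commute
      power2_eq_square field_simps)

lemma has_derivative_inversion:
  fixes w :: "'a::euclidean_space"
  assumes "w \<noteq> 0"
  shows "((\<lambda>w. w /\<^sub>R norm w ^ 2) has_derivative (\<lambda>h. reflection w h /\<^sub>R norm w ^ 2)) (at w)"
proof -
  have "((\<lambda>w. w /\<^sub>R (w \<bullet> w)) has_derivative (\<lambda>h. reflection w h /\<^sub>R (w \<bullet> w))) (at w)"
    using assms
    by (auto intro!: derivative_eq_intros
        simp: reflection_def algebra_simps inner_commute power2_eq_square divide_inverse)
  then show ?thesis
    by (simp add: power2_norm_eq_inner)
qed

text \<open>An isometry with a positive multiple in \<open>CO \<omega>\<close> already lies in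
  \<open>SO \<omega>\<close>, so it pulls \<open>\<omega>\<close> back to the volume form, whose
  value on the standard frame is 1.\<close>

lemma CO_scaled_isometry:
  fixes \<omega> :: "('n::finite \<Rightarrow> real ^ 'm::finite) \<Rightarrow> real" and B :: "real ^ 'n \<Rightarrow> real ^ 'm"
  assumes "(\<lambda>h. s *\<^sub>R B h) \<in> CO \<omega>" "linear_isometry B" "0 < s"
  shows "\<omega> (\<lambda>i. B (axis i 1)) = 1"
proof -
  obtain c L where L: "L \<in> SO \<omega>" "0 \<le> c" and eq: "\<And>h. s *\<^sub>R B h = c *\<^sub>R L h"
    using assms(1) unfolding CO_def by (auto simp: fun_eq_iff)
  \<comment> \<open>Both maps preserve lengths, so the image of a single unit vector determines the
    scale factor.\<close>
  have "norm (s *\<^sub>R B (axis undefined 1)) = norm (c *\<^sub>R L (axis undefined 1))"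
    by (simp only: eq)
  then have "s = c"
    using assms(2,3) L by (simp add: SO_def linear_isometry_def)
  then have "B = L"
    using eq \<open>0 < s\<close> by auto
  then have "\<omega> (\<lambda>i. B (axis i 1)) = vol (\<lambda>i :: 'n. axis i 1)"
    using L(1) by (auto simp: SO_def pullback_def fun_eq_iff o_def dest: spec[of _ "\<lambda>i. axis i 1"])
  also have "(\<chi> i. axis i 1) = (mat 1 :: real ^ 'n ^ 'n)"
    by (simp add: vec_eq_iff mat_def axis_def)
  then have "vol (\<lambda>i. axis i 1 :: real ^ 'n) = 1"
    by (simp add: vol_def)
  finally show ?thesis .
qed

section \<open>Determinants and orientation\<close>

text \<open>Conjugation by \<open>\<iota>\<close> is a sign-preserving bijection between the
  permutations in the two Leibniz sums. Even in equal dimensions the index types differ, so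
  determinants have to be transported.\<close>

lemma det_reindex:
  fixes A :: "'a::comm_ring_1 ^ 'm ^ 'm" and \<iota> :: "'n::finite \<Rightarrow> 'm::finite"
  assumes "bij \<iota>"
  shows "det (\<chi> i j. A $ \<iota> i $ \<iota> j) = det A"
proof -
  let ?T = "map_permutation UNIV \<iota>"
  have inj: "inj \<iota>" and surj: "range \<iota> = UNIV"
    using assms by (auto simp: bij_def)
  have T: "?T p (\<iota> i) = \<iota> (p i)" for p i
    using inj by (simp add: map_permutation_apply)
  have "det (\<chi> i j. A $ \<iota> i $ \<iota> j) =
      (\<Sum>p | p permutes (UNIV :: 'n set). of_int (sign (?T p)) * (\<Prod>i\<in>UNIV. A $ i $ ?T p i))"
    unfolding det_def
  proof (intro sum.cong refl arg_cong2[where f = "(*)"])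
    fix p assume "p \<in> {p. p permutes (UNIV :: 'n set)}"
    then show "of_int (sign p) = (of_int (sign (?T p)) :: 'a)"
      using inj by (simp add: sign_map_permutation)
    have "(\<Prod>i\<in>UNIV. A $ i $ ?T p i) = (\<Prod>i\<in>UNIV. A $ \<iota> i $ ?T p (\<iota> i))"
      using prod.reindex_bij_betw[OF assms[unfolded bij_def[symmetric]], of "\<lambda>i. A $ i $ ?T p i"] by simp
    then show "(\<Prod>i\<in>UNIV. (\<chi> i j. A $ \<iota> i $ \<iota> j) $ i $ p i) = (\<Prod>i\<in>UNIV. A $ i $ ?T p i)"
      by (simp add: T)
  qed
  also have "\<dots> = (\<Sum>q | q permutes (UNIV :: 'm set). of_int (sign q) * (\<Prod>i\<in>UNIV. A $ i $ q i))"
  proof (rule sum.reindex_bij_betw)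
    have "?T = (\<lambda>p x. \<iota> (p (inv \<iota> x)))"
      using surj by (auto simp: map_permutation_def restrict_id_def fun_eq_iff)
    then show "bij_betw ?T {p. p permutes UNIV} {q. q permutes UNIV}"
      using bij_betw_permutations[OF assms] by simp
  qed
  finally show ?thesis
    by (simp add: det_def)
qed

text \<open>A bijective \<open>\<iota>\<close> makes \<open>embed \<iota>\<close> invertible, so the
  frame is the image of one in the source space. The transpose enters because \<open>vol\<close>
  takes vectors as rows while \<open>matrix\<close> stores images of basis vectors as
  columns.\<close>

lemma covector_volume_eq_det:
  assumes "bij \<iota>" "pullback (embed \<iota>) \<omega> = vol"
  shows "\<omega> (\<lambda>i. P (axis (\<iota> i) 1)) = det (matrix P)"
proof -
  have e: "embed \<iota> (\<chi> k. z $ \<iota> k) = z" for z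
    using assms(1) by (auto simp: embed_def vec_eq_iff bij_def surj_f_inv_f)
  have "\<omega> (\<lambda>i. P (axis (\<iota> i) 1)) = pullback (embed \<iota>) \<omega> (\<lambda>i. \<chi> k. P (axis (\<iota> i) 1) $ \<iota> k)"
    by (simp add: pullback_def o_def e)
  also have "\<dots> = det (\<chi> i k. transpose (matrix P) $ \<iota> i $ \<iota> k)"
    by (simp add: assms(2) vol_def transpose_def matrix_def)
  also have "\<dots> = det (matrix P)"
    using det_reindex[OF assms(1), of "transpose (matrix P)"] by simp
  finally show ?thesis .
qed

text \<open>An orthogonal involution of determinant -1, used to correct the sign of a
  determinant.\<close>

definition coordinate_flip :: "'k \<Rightarrow> real ^ 'k \<Rightarrow> real ^ 'k::finite" where
  "coordinate_flip k x = (\<chi> i. if i = k then - x $ i else x $ i)"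

lemma orthogonal_coordinate_flip: "orthogonal_transformation (coordinate_flip k)"
  unfolding orthogonal_transformation_def
  by (auto simp: coordinate_flip_def inner_vec_def vec_eq_iff intro!: linearI sum.cong)

lemma coordinate_flip_flip: "coordinate_flip k (coordinate_flip k x) = x"
  by (simp add: coordinate_flip_def vec_eq_iff)

lemma det_coordinate_flip: "det (matrix (coordinate_flip k)) = -1"
proof -
  have "matrix (coordinate_flip k) $ i $ j = (if i = j then if i = k then -1 else 1 else 0)" for i j
    by (simp add: matrix_def coordinate_flip_def axis_def)
  then have "det (matrix (coordinate_flip k)) = (\<Prod>i\<in>UNIV. if i = k then -1 else 1)"
    by (subst det_diagonal) auto
  then show ?thesis
    by simp
qed

section \<open>Extension of isometries to the ambient space\<close>

text \<open>The two images have equal dimension, hence so do their orthogonal complements. An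
  isometry between the complements, added to \<open>M\<close>, gives the extension.\<close>

lemma linear_isometry_extension:
  fixes M :: "real ^ 'n::finite \<Rightarrow> real ^ 'm::finite"
    and \<iota> :: "'n \<Rightarrow> 'm"
  assumes M: "linear_isometry M" and "inj \<iota>"
  obtains P where "orthogonal_transformation P" "\<And>x. P (embed \<iota> x) = M x"
proof -
  have lin: "linear M" "linear (embed \<iota>)"
    using M linear_embed by (auto simp: linear_isometry_def)
  have inj: "inj M" "inj (embed \<iota>)"
    using M linear_isometry_embed[OF \<open>inj \<iota>\<close>]
    by (auto simp: linear_isometry_def linear_injective_0) (metis norm_eq_zero)+
  define S where "S = {y. \<forall>x\<in>range (embed \<iota>). orthogonal x y}"
  define T where "T = {y. \<forall>x\<in>range M. orthogonal x y}"
  have "subspace (range M)" "subspace (range (embed \<iota>))"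
    using lin by (auto intro: linear_subspace_image)
  then have "dim S + dim (range (embed \<iota>)) = CARD('m)" "dim T + dim (range M) = CARD('m)"
    using dim_subspace_orthogonal_to_vectors[of "range (embed \<iota>)" UNIV]
      dim_subspace_orthogonal_to_vectors[of "range M" UNIV]
    by (simp_all add: S_def T_def)
  moreover have "dim (range (embed \<iota>)) = dim (range M)"
    using lin inj by (simp add: dim_image_eq)
  ultimately have "dim S = dim T"
    by simp
  moreover have "subspace S" "subspace T"
    unfolding S_def T_def by (rule subspace_orthogonal_to_vectors)+
  ultimately obtain f where f: "linear f" "f ` S = T" "\<And>x. x \<in> S \<Longrightarrow> norm (f x) = norm x"
    by (metis isometries_subspaces)
  \<comment> \<open>\<open>\<pi>\<close> is the adjoint of the embedding, so subtracting
    \<open>embed \<iota> (\<pi> z)\<close> from \<open>z\<close> leaves the component in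
    \<open>S\<close>.\<close>
  define \<pi> where "\<pi> z = (\<chi> i. z $ \<iota> i)" for z :: "real ^ 'm"
  have lin_\<pi>: "linear \<pi>"
    by (intro linearI) (auto simp: \<pi>_def vec_eq_iff)
  have S: "z - embed \<iota> (\<pi> z) \<in> S" for z
    using inner_embed[OF \<open>inj \<iota>\<close>, of "z - embed \<iota> (\<pi> z)"]
    by (auto simp: S_def orthogonal_def inner_commute embed_nth[OF \<open>inj \<iota>\<close>] \<pi>_def zero_vec_def[symmetric])
  define P where "P z = M (\<pi> z) + f (z - embed \<iota> (\<pi> z))" for z
  have "linear P"
    unfolding P_def
    by (intro linearI)
      (simp_all add: linear_add[OF lin(1)] linear_add[OF lin(2)] linear_add[OF lin_\<pi>] linear_add[OF f(1)]
        linear_diff[OF f(1)] linear_cmul[OF lin(1)] linear_cmul[OF lin(2)] linear_cmul[OF lin_\<pi>]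
        linear_cmul[OF f(1)] algebra_simps)
  moreover have "norm (P z) = norm z" for z
  proof -
    have "f (z - embed \<iota> (\<pi> z)) \<in> T"
      using f(2) S by blast
    then have "orthogonal (M (\<pi> z)) (f (z - embed \<iota> (\<pi> z)))"
      by (auto simp: T_def)
    then have "norm (P z) ^ 2 = norm (M (\<pi> z)) ^ 2 + norm (f (z - embed \<iota> (\<pi> z))) ^ 2"
      unfolding P_def by (rule norm_add_Pythagorean)
    also have "\<dots> = norm (embed \<iota> (\<pi> z)) ^ 2 + norm (z - embed \<iota> (\<pi> z)) ^ 2"
      using M linear_isometry_embed[OF \<open>inj \<iota>\<close>] f(3)[OF S] by (simp add: linear_isometry_def)
    also have "\<dots> = norm (embed \<iota> (\<pi> z) + (z - embed \<iota> (\<pi> z))) ^ 2"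
      using S[of z] by (intro norm_add_Pythagorean[symmetric]) (auto simp: S_def)
    finally show ?thesis
      by simp
  qed
  ultimately have "orthogonal_transformation P"
    by (simp add: orthogonal_transformation)
  moreover have "P (embed \<iota> x) = M x" for x
    using f(1) by (simp add: P_def \<pi>_def embed_nth[OF \<open>inj \<iota>\<close>] linear_0)
  ultimately show ?thesis
    using that by blast
qed

section \<open>Conformal curves given by similarities and inversions\<close>

lemma conformal_curve_AE_derivative:
  fixes F :: "real ^ 'n::finite \<Rightarrow> real ^ 'm::finite"
  assumes "open \<Omega>" "conformal_curve \<omega> \<Omega> F"
    and D: "\<And>x. x \<in> \<Omega> \<Longrightarrow> (F has_derivative D x) (at x)"
    and cont: "\<And>v. continuous_on \<Omega> (\<lambda>x. D x v)"
  shows "AE x in lebesgue_on \<Omega>. x \<in> \<Omega> \<and> D x \<in> CO \<omega>"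
proof -
  obtain G where G: "W1_loc CARD('n) \<Omega> F G" "AE x in lebesgue_on \<Omega>. (\<lambda>h. G x *v h) \<in> CO \<omega>"
    using assms(2) by (auto simp: conformal_curve_def)
  have "1 \<le> CARD('n)"
    by (simp add: Suc_leI)
  with G(1) have "AE x in lebesgue_on \<Omega>. (\<lambda>v. G x *v v) = D x"
    by (rule weak_derivative_eq_derivative[OF \<open>open \<Omega>\<close> _ _ D cont])
  moreover have "AE x in lebesgue_on \<Omega>. x \<in> \<Omega>"
    using AE_space[of "lebesgue_on \<Omega>"] by simp
  ultimately show ?thesis
    using G(2) by eventually_elim simp
qed

lemma conformal_affine_value:
  fixes \<omega> :: "('n::finite \<Rightarrow> real ^ 'm::finite) \<Rightarrow> real"
  assumes "inj \<iota>" "open \<Omega>" "\<Omega> \<noteq> {}" "conformal_curve \<omega> \<Omega> F"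
    and P: "linear_isometry P" and "0 < c"
    and F: "\<And>x. x \<in> \<Omega> \<Longrightarrow> F x = y0 + c *\<^sub>R P (embed \<iota> x - x0)"
  shows "\<omega> (\<lambda>i. P (axis (\<iota> i) 1)) = 1"
proof -
  let ?B = "\<lambda>h. P (embed \<iota> h)"
  have B: "linear_isometry ?B"
    by (rule linear_isometry_compose[OF P linear_isometry_embed[OF \<open>inj \<iota>\<close>]])
  have lin: "linear P"
    using P by (simp add: linear_isometry_def)
  have D: "(F has_derivative (\<lambda>h. c *\<^sub>R ?B h)) (at x)" if "x \<in> \<Omega>" for x
  proof -
    have "(?B has_derivative ?B) (at x)"
      using B by (intro linear_imp_has_derivative) (simp add: linear_isometry_def)
    then have "((\<lambda>x. (y0 - c *\<^sub>R P x0) + c *\<^sub>R ?B x) has_derivative (\<lambda>h. c *\<^sub>R ?B h)) (at x)"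
      by (auto intro!: derivative_eq_intros)
    then show ?thesis
      by (rule has_derivative_transform_within_open[OF _ \<open>open \<Omega>\<close> that])
        (simp add: F linear_diff[OF lin] algebra_simps)
  qed
  have "AE x in lebesgue_on \<Omega>. x \<in> \<Omega> \<and> (\<lambda>h. c *\<^sub>R ?B h) \<in> CO \<omega>"
    by (rule conformal_curve_AE_derivative[OF \<open>open \<Omega>\<close> assms(4) D]) auto
  then have "AE x in lebesgue_on \<Omega>. \<omega> (\<lambda>i. ?B (axis i 1)) - 1 = 0"
    by eventually_elim (use CO_scaled_isometry[OF _ B \<open>0 < c\<close>] in auto)
  \<comment> \<open>The expression is constant in x, and a constant that is zero almost everywhere
    on a nonempty open set is zero.\<close>
  then have "\<omega> (\<lambda>i. ?B (axis i 1)) - 1 = 0"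
    using continuous_AE_zero_imp_zero[OF \<open>open \<Omega>\<close> continuous_on_const] \<open>\<Omega> \<noteq> {}\<close> by blast
  then show ?thesis
    by (simp add: embed_axis[OF \<open>inj \<iota>\<close>])
qed

text \<open>The differential of an inversion is a positive multiple of an isometry, so the value is
  1 almost everywhere; continuity in \<open>x\<close> extends this to every point.\<close>

lemma conformal_inversion_identity:
  fixes \<omega> :: "('n::finite \<Rightarrow> real ^ 'm::finite) \<Rightarrow> real" and P :: "real ^ 'm \<Rightarrow> real ^ 'm"
  assumes "covector \<omega>" "inj \<iota>" "open \<Omega>" "conformal_curve \<omega> \<Omega> F"
    and P: "linear_isometry P" and "0 < c"
    and x0: "\<And>x. x \<in> \<Omega> \<Longrightarrow> embed \<iota> x \<noteq> x0"
    and F: "\<And>x. x \<in> \<Omega> \<Longrightarrow> F x = y0 + c *\<^sub>R P ((embed \<iota> x - x0) /\<^sub>R norm (embed \<iota> x - x0) ^ 2)"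
    and "x \<in> \<Omega>"
  shows "\<omega> (\<lambda>i. P (reflection (embed \<iota> x - x0) (axis (\<iota> i) 1))) = 1"
proof -
  define w where "w x = embed \<iota> x - x0" for x
  have w: "w x \<noteq> 0" if "x \<in> \<Omega>" for x
    using x0[OF that] by (simp add: w_def)
  have linP: "linear P"
    using P by (simp add: linear_isometry_def)
  have lin_refl: "linear_isometry (reflection z)" for z :: "real ^ 'm"
    by (simp add: linear_isometry_def linear_reflection norm_reflection)
  define B where "B x h = P (reflection (w x) (embed \<iota> h))" for x h
  have B: "linear_isometry (B x)" for x
    unfolding B_def
    by (intro linear_isometry_compose[OF P] linear_isometry_compose[OF lin_refl] linear_isometry_embed \<open>inj \<iota>\<close>)
  have cont_w: "continuous_on S w" for S
    unfolding w_def by (intro continuous_intros linear_continuous_on)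
      (simp add: linear_embed flip: linear_conv_bounded_linear)
  have cont_B: "continuous_on \<Omega> (\<lambda>x. B x h)" for h
    unfolding B_def reflection_def
    by (intro continuous_on_compose2[OF linear_continuous_on[of P UNIV]] continuous_intros cont_w)
      (use linP w in \<open>auto simp flip: linear_conv_bounded_linear\<close>)
  have D: "(F has_derivative (\<lambda>h. (c / norm (w x) ^ 2) *\<^sub>R B x h)) (at x)" if "x \<in> \<Omega>" for x
  proof -
    have "(w has_derivative embed \<iota>) (at x)"
      unfolding w_def using linear_imp_has_derivative[OF linear_embed]
      by (auto intro!: derivative_eq_intros)
    from has_derivative_compose[OF this has_derivative_inversion[OF w[OF that]]]
    have "((\<lambda>x. w x /\<^sub>R norm (w x) ^ 2) has_derivative
        (\<lambda>h. reflection (w x) (embed \<iota> h) /\<^sub>R norm (w x) ^ 2)) (at x)" .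
    from has_derivative_compose[OF this linear_imp_has_derivative[OF linP]]
    have "((\<lambda>x. y0 + c *\<^sub>R P (w x /\<^sub>R norm (w x) ^ 2)) has_derivative
        (\<lambda>h. c *\<^sub>R P (reflection (w x) (embed \<iota> h) /\<^sub>R norm (w x) ^ 2))) (at x)"
      by (auto intro!: derivative_eq_intros)
    then have "(F has_derivative (\<lambda>h. c *\<^sub>R P (reflection (w x) (embed \<iota> h) /\<^sub>R norm (w x) ^ 2))) (at x)"
      by (rule has_derivative_transform_within_open[OF _ \<open>open \<Omega>\<close> that]) (simp add: F w_def)
    then show ?thesis
      by (simp add: linear_cmul[OF linP] B_def divide_inverse)
  qed
  have "AE x in lebesgue_on \<Omega>. x \<in> \<Omega> \<and> (\<lambda>h. (c / norm (w x) ^ 2) *\<^sub>R B x h) \<in> CO \<omega>"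
    by (rule conformal_curve_AE_derivative[OF \<open>open \<Omega>\<close> assms(4) D])
      (auto intro!: continuous_intros cont_B cont_w simp: w)
  then have AE: "AE x in lebesgue_on \<Omega>. \<omega> (\<lambda>i. B x (axis i 1)) - 1 = 0"
    by eventually_elim (use CO_scaled_isometry[OF _ B] w \<open>0 < c\<close> in auto)
  let ?\<omega> = "\<lambda>v. \<omega> (P \<circ> v)"
  have \<omega>P: "covector ?\<omega>"
    by (rule covector_compose_linear[OF assms(1) linP])
  have "\<omega> (\<lambda>i. B x (axis i 1)) = ?\<omega> (\<lambda>i. axis (\<iota> i) 1 - (2 * (w x $ \<iota> i) / (w x \<bullet> w x)) *\<^sub>R w x)" for x
    by (simp add: B_def reflection_def o_def embed_axis[OF \<open>inj \<iota>\<close>] inner_axis)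
  \<comment> \<open>The expansion involves \<open>w x\<close> only through coordinates, inner
    products and linear functionals, so continuity can be read off.\<close>
  then have expand: "\<omega> (\<lambda>i. B x (axis i 1)) = ?\<omega> (\<lambda>i. axis (\<iota> i) 1) -
      (\<Sum>i\<in>UNIV. 2 * (w x $ \<iota> i) / (w x \<bullet> w x) * ?\<omega> ((\<lambda>i. axis (\<iota> i) 1)(i := w x)))" for x
    by (simp only: covector_rank_one_update[OF \<omega>P])
  have "continuous_on \<Omega> (\<lambda>x. ?\<omega> ((\<lambda>i. axis (\<iota> i) 1)(i := w x)))" for i
    by (rule continuous_on_compose2[OF linear_continuous_on[of _ UNIV] cont_w])
      (rule covector_linear[OF \<omega>P, unfolded linear_conv_bounded_linear], simp)
  then have "continuous_on \<Omega> (\<lambda>x. \<omega> (\<lambda>i. B x (axis i 1)) - 1)"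
    unfolding expand by (intro continuous_intros cont_w) (auto simp: w)
  then have "\<omega> (\<lambda>i. B x (axis i 1)) - 1 = 0"
    using AE \<open>x \<in> \<Omega>\<close> by (rule continuous_AE_zero_imp_zero[OF \<open>open \<Omega>\<close>])
  then show ?thesis
    by (simp add: B_def w_def embed_axis[OF \<open>inj \<iota>\<close>])
qed

text \<open>The first conclusion places the centre in the source space; the second comes from the
  same comparison of coefficients and fixes the orientation when the dimensions agree.\<close>

lemma conformal_inversion:
  fixes \<omega> :: "('n::finite \<Rightarrow> real ^ 'm::finite) \<Rightarrow> real" and P :: "real ^ 'm \<Rightarrow> real ^ 'm"
  assumes "covector \<omega>" "inj \<iota>" "open \<Omega>" "\<Omega> \<noteq> {}" "conformal_curve \<omega> \<Omega> F"
    and P: "linear_isometry P" and "0 < c"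
    and x0: "\<And>x. x \<in> \<Omega> \<Longrightarrow> embed \<iota> x \<noteq> x0"
    and F: "\<And>x. x \<in> \<Omega> \<Longrightarrow> F x = y0 + c *\<^sub>R P ((embed \<iota> x - x0) /\<^sub>R norm (embed \<iota> x - x0) ^ 2)"
  shows "x0 \<in> range (embed \<iota>)" "\<omega> (\<lambda>i. P (axis (\<iota> i) 1)) = -1"
proof -
  have linP: "linear P"
    using P by (simp add: linear_isometry_def)
  define \<omega>P where "\<omega>P v = \<omega> (P \<circ> v)" for v
  have cov: "covector \<omega>P"
    unfolding \<omega>P_def by (rule covector_compose_linear[OF assms(1) linP])
  define e :: "'n \<Rightarrow> real ^ 'm" where "e i = axis (\<iota> i) 1" for i
  \<comment> \<open>\<open>embed \<iota> p\<close> is the orthogonal projection of the centre onto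
    the coordinate subspace, and \<open>k\<close> is the normal component.\<close>
  define p where "p = (\<chi> i. x0 $ \<iota> i)"
  define k where "k = x0 - embed \<iota> p"
  define a where "a = \<omega>P e"
  define b where "b = (\<chi> i. \<omega>P (e(i := k)))"
  have k: "k \<bullet> embed \<iota> y = 0" for y
    using \<open>inj \<iota>\<close> by (simp add: k_def inner_embed inner_diff_left embed_nth p_def)
  have identity: "a * (k \<bullet> k - (x - p) \<bullet> (x - p)) + 2 * ((x - p) \<bullet> b) = (x - p) \<bullet> (x - p) + k \<bullet> k"
    if "x \<in> \<Omega>" for x
  proof -
    define u where "u = x - p"
    define w where "w = embed \<iota> x - x0"
    have w: "w = embed \<iota> u - k"
      by (simp add: w_def u_def k_def linear_diff[OF linear_embed])
    have ww: "w \<bullet> w = u \<bullet> u + k \<bullet> k"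
      using k[of u] inner_embed_embed[OF \<open>inj \<iota>\<close>, of u u]
      by (simp add: w inner_diff_left inner_diff_right inner_commute)
    have wi: "w $ \<iota> i = u $ i" for i
      by (simp add: w_def u_def p_def embed_nth[OF \<open>inj \<iota>\<close>])
    have "w \<bullet> w \<noteq> 0"
      using x0[OF that] by (simp add: w_def)
    \<comment> \<open>Of the tangential part of \<open>w\<close> only the component along
      \<open>e i\<close> survives, since any other frame vector would occur twice.\<close>
    have frame_value: "\<omega>P (e(i := w)) = u $ i * a - b $ i" for i
    proof -
      have lin: "linear (\<lambda>z. \<omega>P (e(i := z)))"
        by (rule covector_linear[OF cov])
      have "embed \<iota> u = embed \<iota> (\<Sum>j\<in>UNIV. u $ j *\<^sub>R axis j 1)"
        using basis_expansion[of u] by (simp add: scalar_mult_eq_scaleR)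
      also have "\<dots> = (\<Sum>j\<in>UNIV. u $ j *\<^sub>R e j)"
        by (simp add: linear_sum[OF linear_embed] linear_cmul[OF linear_embed] e_def embed_axis[OF \<open>inj \<iota>\<close>])
      finally have "\<omega>P (e(i := w)) = (\<Sum>j\<in>UNIV. u $ j * \<omega>P (e(i := e j))) - b $ i"
        by (simp add: w linear_diff[OF lin] linear_sum[OF lin] linear_cmul[OF lin] b_def)
      also have "(\<Sum>j\<in>UNIV. u $ j * \<omega>P (e(i := e j))) = (\<Sum>j\<in>UNIV. if j = i then u $ i * a else 0)"
      proof (rule sum.cong)
        fix j
        have "\<omega>P (e(i := e j)) = 0" if "j \<noteq> i"
          using that by (intro covector_repeat[OF cov, of j i]) auto
        then show "u $ j * \<omega>P (e(i := e j)) = (if j = i then u $ i * a else 0)"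
          by (auto simp: a_def)
      qed simp
      finally show ?thesis
        by (simp add: fun_upd_def)
    qed
    have "1 = \<omega> (\<lambda>i. P (reflection w (axis (\<iota> i) 1)))"
      unfolding w_def
      by (rule conformal_inversion_identity[OF assms(1,2,3,5) P \<open>0 < c\<close> x0 F that, symmetric])
    also have "\<dots> = \<omega>P (\<lambda>i. e i - (2 * u $ i / (w \<bullet> w)) *\<^sub>R w)"
      by (simp add: \<omega>P_def reflection_def o_def e_def inner_axis wi)
    also have "\<dots> = a - (\<Sum>i\<in>UNIV. 2 * u $ i / (w \<bullet> w) * (u $ i * a - b $ i))"
      by (simp only: covector_rank_one_update[OF cov] frame_value a_def)
    also have "\<dots> = a - 2 * ((u \<bullet> u) * a - u \<bullet> b) / (w \<bullet> w)"
      by (simp add: inner_vec_def sum_distrib_left sum_distrib_right sum_subtractf sum_divide_distrib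
          algebra_simps diff_divide_distrib)
    finally have "w \<bullet> w = a * (w \<bullet> w) - 2 * ((u \<bullet> u) * a - u \<bullet> b)"
      using \<open>w \<bullet> w \<noteq> 0\<close> by (simp add: field_simps)
    then show ?thesis
      unfolding ww u_def by (simp add: algebra_simps)
  qed
  obtain z where "z \<in> \<Omega>"
    using \<open>\<Omega> \<noteq> {}\<close> by blast
  then obtain r where r: "0 < r" "ball z r \<subseteq> \<Omega>"
    using \<open>open \<Omega>\<close> by (meson openE)
  have near: "z + v \<in> \<Omega>" if "norm v < r" for v
    using r(2) that by (auto simp: subset_iff dist_norm)
  define v :: "real ^ 'n" where "v = (r / 2) *\<^sub>R axis undefined 1"
  have v: "norm v < r" "v \<bullet> v \<noteq> 0"
    using r(1) by (auto simp: v_def inner_axis_axis)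
  \<comment> \<open>The second difference of the identity at \<open>z + v\<close>, \<open>z\<close>
    and \<open>z - v\<close> removes the constant and linear terms.\<close>
  have "(a + 1) * (v \<bullet> v) = 0"
    using identity[OF near[OF v(1)]] identity[OF near[of "- v"]] identity[OF \<open>z \<in> \<Omega>\<close>] v(1)
    by (simp add: inner_add_left inner_add_right inner_diff_left inner_diff_right inner_commute algebra_simps)
  then have a: "a = -1"
    using v(2) by simp
  then show "\<omega> (\<lambda>i. P (axis (\<iota> i) 1)) = -1"
    by (simp add: a_def \<omega>P_def e_def o_def)
  have id': "(x - p) \<bullet> b = k \<bullet> k" if "x \<in> \<Omega>" for x
    using identity[OF that] a by simp
  have "b = 0"
  proof (rule ccontr)
    assume "b \<noteq> 0"
    \<comment> \<open>This factor gives \<open>s *\<^sub>R b\<close> the length r/2, so the shifted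
      point stays in the ball, while the inner product with \<open>b\<close> would change.\<close>
    define s where "s = r / (2 * norm b)"
    have "s \<noteq> 0" "norm (s *\<^sub>R b) < r"
      using r(1) \<open>b \<noteq> 0\<close> by (auto simp: s_def)
    have "s * (b \<bullet> b) = (z + s *\<^sub>R b - p) \<bullet> b - (z - p) \<bullet> b"
      by (simp add: inner_add_left inner_diff_left)
    also have "\<dots> = 0"
      using id'[OF near[OF \<open>norm (s *\<^sub>R b) < r\<close>]] id'[OF \<open>z \<in> \<Omega>\<close>] by simp
    finally show False
      using \<open>s \<noteq> 0\<close> \<open>b \<noteq> 0\<close> by simp
  qed
  then have "k = 0"
    using id'[OF \<open>z \<in> \<Omega>\<close>] by simp
  then show "x0 \<in> range (embed \<iota>)"
    by (simp add: k_def)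
qed

section \<open>The two implications\<close>

text \<open>The matrix \<open>Q\<close> restricted to the coordinate subspace supplies the isometry,
  and scaling or inversion takes place inside the source space. In the inversion case this relies on
  the centre lying there.\<close>

lemma moebius_restriction_imp_inner_moebius_curve:
  fixes \<omega> :: "('n::finite \<Rightarrow> real ^ 'm::finite) \<Rightarrow> real"
  assumes cov: "covector \<omega>" and \<iota>: "inj \<iota>"
    and \<Omega>: "open \<Omega>" and nonempty: "\<Omega> \<noteq> {}" and F: "conformal_curve \<omega> \<Omega> F"
    and "moebius_restriction \<iota> \<Omega> F"
  shows "inner_moebius_curve \<Omega> F"
proof -
  note E = linear_isometry_embed[OF \<iota>]
  obtain \<epsilon> x0 y0 c Q where c: "0 < c" and Q: "orthogonal_matrix Q"
    and \<epsilon>: "\<epsilon> = 0 \<and> det Q = 1 \<or> \<epsilon> = 2 \<and> det Q = -1"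
    and FT: "\<And>x. x \<in> \<Omega> \<Longrightarrow> moebius_map \<epsilon> x0 y0 c Q (Some (embed \<iota> x)) = Some (F x)"
    using assms(6) unfolding moebius_restriction_def moebius_def by blast
  have PQ: "linear_isometry ((*v) Q)"
    by (rule linear_isometry_orthogonal_matrix[OF Q])
  show "inner_moebius_curve \<Omega> F"
  proof (cases "\<epsilon> = 0")
    case True
    let ?L = "\<lambda>x. Q *v embed \<iota> x"
    let ?T = "moebius_map 0 0 0 c (mat 1) :: (real ^ 'n) option \<Rightarrow> _"
    have "moebius ?T"
      unfolding moebius_def using c by (intro exI conjI) (auto simp: orthogonal_matrix_def)
    moreover have L: "linear_isometry ?L"
      by (rule linear_isometry_compose[OF PQ E])
    moreover have "F x = (y0 - c *\<^sub>R (Q *v x0)) + ?L (c *\<^sub>R x)" if "x \<in> \<Omega>" for x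
      using FT[OF that] True
      by (auto simp: moebius_map_def linear_cmul[OF linear_embed] matrix_vector_mult_diff_distrib
          matrix_vector_mult_scaleR algebra_simps)
    ultimately show ?thesis
      unfolding inner_moebius_curve_def
      by (intro exI[of _ "y0 - c *\<^sub>R (Q *v x0)"] exI[of _ ?L] exI[of _ "\<lambda>x. c *\<^sub>R x"] exI[of _ ?T])
        (simp add: moebius_map_def)
  next
    case False
    with \<epsilon> have \<epsilon>: "\<epsilon> = 2"
      by auto
    have x0: "embed \<iota> x \<noteq> x0" and F_eq: "F x = y0 + c *\<^sub>R (Q *v ((embed \<iota> x - x0) /\<^sub>R norm (embed \<iota> x - x0) ^ 2))"
      if "x \<in> \<Omega>" for x
      using FT[OF that] by (auto simp: moebius_map_def \<epsilon> split: if_splits)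
    obtain p where p: "x0 = embed \<iota> p"
      using conformal_inversion(1)[OF cov \<iota> \<Omega> nonempty F PQ c x0 F_eq] by auto
    \<comment> \<open>An inversion in the source space needs an orthogonal part of determinant -1;
      the flip provides it in \<open>?g\<close> and is undone in \<open>?L\<close>.\<close>
    let ?R = "coordinate_flip undefined :: real ^ 'n \<Rightarrow> real ^ 'n"
    have linR: "linear ?R"
      using orthogonal_coordinate_flip by (rule orthogonal_transformation_linear)
    have R: "linear_isometry ?R"
      using orthogonal_coordinate_flip by (simp add: linear_isometry_def orthogonal_transformation)
    have mR: "matrix ?R *v x = ?R x" for x
      using matrix_vector_mul(2)[OF linR] by metis
    let ?L = "\<lambda>x. Q *v embed \<iota> (?R x)"
    let ?T = "moebius_map 2 p 0 c (matrix ?R)"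
    let ?g = "\<lambda>x. c *\<^sub>R ?R ((x - p) /\<^sub>R norm (x - p) ^ 2)"
    have "orthogonal_matrix (matrix ?R)"
      using orthogonal_coordinate_flip orthogonal_transformation_matrix by blast
    then have "moebius ?T"
      unfolding moebius_def using c det_coordinate_flip by blast
    moreover have "linear_isometry ?L"
      by (rule linear_isometry_compose[OF PQ linear_isometry_compose[OF E R]])
    moreover have "?T (Some x) = Some (?g x) \<and> F x = y0 + ?L (?g x)" if "x \<in> \<Omega>" for x
    proof
      show "?T (Some x) = Some (?g x)"
        using x0[OF that] by (auto simp: moebius_map_def p mR)
      have n: "norm (embed \<iota> (x - p)) = norm (x - p)"
        using E by (simp add: linear_isometry_def)
      show "F x = y0 + ?L (?g x)"
        unfolding F_eq[OF that] p linear_diff[OF linear_embed, symmetric] n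
        by (simp add: linear_cmul[OF linR] linear_cmul[OF linear_embed] coordinate_flip_flip
            matrix_vector_mult_scaleR)
    qed
    ultimately show ?thesis
      unfolding inner_moebius_curve_def
      by (intro exI[of _ y0] exI[of _ ?L] exI[of _ ?g] exI[of _ ?T]) blast
  qed
qed

lemma inner_moebius_curve_imp_moebius_restriction:
  fixes \<omega> :: "('n::finite \<Rightarrow> real ^ 'm::finite) \<Rightarrow> real"
  assumes cov: "covector \<omega>" and \<iota>: "inj \<iota>"
    and orientation: "CARD('n) = CARD('m) \<longrightarrow> pullback (embed \<iota>) \<omega> = vol"
    and \<Omega>: "open \<Omega>" and nonempty: "\<Omega> \<noteq> {}" and F: "conformal_curve \<omega> \<Omega> F"
    and "inner_moebius_curve \<Omega> F"
  shows "moebius_restriction \<iota> \<Omega> F"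
proof -
  note E = linear_isometry_embed[OF \<iota>]
  obtain y0 L g \<epsilon> x1 y1 c Q where L: "linear_isometry L"
    and c: "0 < c" and Q: "orthogonal_matrix Q"
    and \<epsilon>: "\<epsilon> = 0 \<and> det Q = 1 \<or> \<epsilon> = 2 \<and> det Q = -1"
    and gT: "\<And>x. x \<in> \<Omega> \<Longrightarrow> moebius_map \<epsilon> x1 y1 c Q (Some x) = Some (g x)"
    and Fg: "\<And>x. x \<in> \<Omega> \<Longrightarrow> F x = y0 + L (g x)"
    using assms(7) unfolding inner_moebius_curve_def moebius_def by blast
  have linL: "linear L"
    using L by (simp add: linear_isometry_def)
  let ?M = "\<lambda>x. L (Q *v x)"
  have M: "linear_isometry ?M"
    by (rule linear_isometry_compose[OF L linear_isometry_orthogonal_matrix[OF Q]])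
  have g: "g x = y1 + c *\<^sub>R (Q *v ((x - x1) /\<^sub>R norm (x - x1) ^ \<epsilon>))" "\<epsilon> = 2 \<Longrightarrow> x \<noteq> x1"
    if "x \<in> \<Omega>" for x
    using gT[OF that] by (auto simp: moebius_map_def split: if_splits)
  \<comment> \<open>The determinant that a Moebius transformation with exponent \<epsilon> must
    have.\<close>
  define \<delta> :: real where "\<delta> = (if \<epsilon> = 0 then 1 else -1)"
  \<comment> \<open>Stated for every \<open>P\<close> extending \<open>?M\<close>, so that
    \<open>P\<close> can later be changed off the coordinate subspace.\<close>
  have F_eq: "F x = (y0 + L y1) + c *\<^sub>R P ((embed \<iota> x - embed \<iota> x1) /\<^sub>R norm (embed \<iota> x - embed \<iota> x1) ^ \<epsilon>)"
    if "x \<in> \<Omega>" "\<And>x. P (embed \<iota> x) = ?M x" for x P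
  proof -
    have "norm (embed \<iota> (x - x1)) = norm (x - x1)"
      using E by (simp add: linear_isometry_def)
    then show ?thesis
      using that(2)[of "(x - x1) /\<^sub>R norm (x - x1) ^ \<epsilon>"]
      by (simp add: Fg[OF that(1)] g[OF that(1)] linear_add[OF linL] linear_cmul[OF linL]
          linear_cmul[OF linear_embed] flip: linear_diff[OF linear_embed])
  qed
  obtain P where P: "orthogonal_transformation P" "\<And>x. P (embed \<iota> x) = ?M x" and det: "det (matrix P) = \<delta>"
  proof -
    obtain P where P: "orthogonal_transformation P" "\<And>x. P (embed \<iota> x) = ?M x"
      using linear_isometry_extension[OF M \<iota>] by metis
    have iso: "linear_isometry P"
      using P(1) by (simp add: linear_isometry_def orthogonal_transformation)
    show thesis
    proof (cases "det (matrix P) = \<delta>")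
      case True
      then show ?thesis
        using that P by blast
    next
      case False
      have "det (matrix P) = 1 \<or> det (matrix P) = -1"
        using P(1) det_orthogonal_matrix orthogonal_transformation_matrix by blast
      with False have det: "det (matrix P) = - \<delta>"
        by (auto simp: \<delta>_def split: if_splits)
      \<comment> \<open>In equal dimensions the normalisation of \<open>\<omega>\<close> makes its
        value on the frame equal to the determinant of \<open>P\<close>, while conformality forces
        the value \<open>\<delta>\<close>.\<close>
      have "\<not> surj \<iota>"
      proof
        assume "surj \<iota>"
        then have "bij \<iota>"
          using \<iota> by (simp add: bij_def)
        then have "CARD('n) = CARD('m)"
          by (rule bij_betw_same_card)
        then have val: "\<omega> (\<lambda>i. P (axis (\<iota> i) 1)) = det (matrix P)"
          using covector_volume_eq_det[OF \<open>bij \<iota>\<close>] orientation by blast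
        show False
        proof (cases "\<epsilon> = 0")
          case True
          have "\<omega> (\<lambda>i. P (axis (\<iota> i) 1)) = 1"
            using F_eq[OF _ P(2)] True
            by (intro conformal_affine_value[OF \<iota> \<Omega> nonempty F iso c, of "y0 + L y1" "embed \<iota> x1"]) auto
          then show False
            using val det True by (simp add: \<delta>_def)
        next
          case False
          with \<epsilon> have "\<epsilon> = 2"
            by auto
          have "\<omega> (\<lambda>i. P (axis (\<iota> i) 1)) = -1"
          proof (rule conformal_inversion(2)[OF cov \<iota> \<Omega> nonempty F iso c])
            show "embed \<iota> x \<noteq> embed \<iota> x1" if "x \<in> \<Omega>" for x
              using g(2)[OF that \<open>\<epsilon> = 2\<close>] \<iota> embed_nth by (metis vec_eq_iff)
            show "F x = (y0 + L y1) + c *\<^sub>R P ((embed \<iota> x - embed \<iota> x1) /\<^sub>R norm (embed \<iota> x - embed \<iota> x1) ^ 2)"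
              if "x \<in> \<Omega>" for x
              using F_eq[OF that P(2)] \<open>\<epsilon> = 2\<close> by simp
          qed
          then show False
            using val det False by (simp add: \<delta>_def)
        qed
      qed
      then obtain j where j: "j \<notin> range \<iota>"
        by blast
      \<comment> \<open>Flipping a coordinate outside the range of \<open>\<iota>\<close> fixes the
        embedded subspace pointwise and reverses the determinant.\<close>
      let ?P = "P \<circ> coordinate_flip j"
      have "orthogonal_transformation ?P"
        by (intro orthogonal_transformation_compose P orthogonal_coordinate_flip)
      moreover have "coordinate_flip j (embed \<iota> x) = embed \<iota> x" for x
        using j by (simp add: coordinate_flip_def embed_def vec_eq_iff)
      then have "?P (embed \<iota> x) = ?M x" for x
        by (simp add: P(2))
      moreover have "det (matrix ?P) = \<delta>"
        using det matrix_compose[OF orthogonal_transformation_linear[OF orthogonal_coordinate_flip]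
            orthogonal_transformation_linear[OF P(1)]]
        by (simp add: det_mul det_coordinate_flip)
      ultimately show ?thesis
        using that by blast
    qed
  qed
  have mP: "matrix P *v x = P x" for x
    using matrix_vector_mul(2)[OF orthogonal_transformation_linear[OF P(1)]] by metis
  let ?T = "moebius_map \<epsilon> (embed \<iota> x1) (y0 + L y1) c (matrix P)"
  have "orthogonal_matrix (matrix P)"
    using P(1) orthogonal_transformation_matrix by blast
  then have "moebius ?T"
    unfolding moebius_def using c det \<epsilon> by (intro exI conjI) (auto simp: \<delta>_def)
  moreover have "?T (Some (embed \<iota> x)) = Some (F x)" if "x \<in> \<Omega>" for x
  proof -
    have "embed \<iota> x \<noteq> embed \<iota> x1" if "\<epsilon> = 2"
      using g(2)[OF \<open>x \<in> \<Omega>\<close> that] \<iota> embed_nth by (metis vec_eq_iff)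
    then show ?thesis
      by (simp add: moebius_map_def mP F_eq[OF that P(2)])
  qed
  ultimately show "moebius_restriction \<iota> \<Omega> F"
    unfolding moebius_restriction_def by blast
qed

theorem theorem1p3:
  fixes \<omega> :: "('n::finite \<Rightarrow> real ^ 'm::finite) \<Rightarrow> real"
    and \<Omega> :: "(real ^ 'n) set"
    and F :: "real ^ 'n \<Rightarrow> real ^ 'm"
    and \<iota> :: "'n \<Rightarrow> 'm"
  assumes dims: "3 \<le> CARD('n)" "CARD('n) \<le> CARD('m)"
    and \<iota>: "inj \<iota>"
    and \<omega>: "calibration \<omega>"
    and orientation: "CARD('n) = CARD('m) \<longrightarrow> pullback (embed \<iota>) \<omega> = vol"
    and \<Omega>: "open \<Omega>" "connected \<Omega>"
    and F: "continuous_on \<Omega> F" "conformal_curve \<omega> \<Omega> F" "\<not> F constant_on \<Omega>"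
  shows "moebius_restriction \<iota> \<Omega> F \<longleftrightarrow> inner_moebius_curve \<Omega> F"
proof -
  have "covector \<omega>"
    using \<omega> by (simp add: calibration_def)
  \<comment> \<open>Every function is constant on the empty set, so nonconstancy gives a point of
    \<open>\<Omega>\<close>.\<close>
  moreover have "\<Omega> \<noteq> {}"
    using F(3) by (auto simp: constant_on_def)
  ultimately show ?thesis
    using moebius_restriction_imp_inner_moebius_curve[OF _ \<iota> \<Omega>(1) _ F(2)]
      inner_moebius_curve_imp_moebius_restriction[OF _ \<iota> orientation \<Omega>(1) _ F(2)] by blast
qed

end
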